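(* Let $\lambda>0$, $\alpha>0$, $|\beta|<\alpha$, and let $F_T$, $Q_T$ be the distribution and quantile functions of the variance gamma distribution with parameters $(\lambda,\alpha,\beta,\mu)$, $\mu=0$. Let $p_-=F_T(0)$, $p_+=1-p_-$, and let $Q_B$ be the base quantile function and $g$ the function given in the context. The function $A$ with $Q_T=A\circ Q_B$ satisfies a left and a right problem. Left problem: choose $u_0\in(0,p_-]$, put $z_0=Q_B(u_0)$, and consider $$\frac{dA}{dz}=g_L(z):=p_-(\alpha+\beta)e^{(\alpha+\beta)z}g(A(z)),\quad z\le Q_B(p_-),\qquad A(z_0)=x_0=Q_T(u_0).$$ Right problem: choose $u_0\in[p_-,1)$, put $z_0=Q_B(u_0)$, and consider $$\frac{dA}{dz}=g_R(z):=p_+(\alpha-\beta)e^{-(\alpha-\beta)z}g(A(z)),\quad z>Q_B(p_-),\qquad A(z_0)=x_0=Q_T(u_0).$$ Suppose that the series solution of either problem is given by $$A(z)=\sum_{n=0}^\infty a_n(z-z_0)^n.$$ Then $a_0$ is determined by the initial condition imposed at $z_0$ ($a_0=x_0$), and the remaining coefficients are given by $$a_n=g_L^{(n-1)}(z_0),\quad n\ge1,$$ for the left problem and $$a_n=g_R^{(n-1)}(z_0),\quad n\ge1,$$ for the right problem, where $$g_L^{(n)}(z)=p_-e^{(\alpha+\beta)z}\sum_{k=0}^n\binom nk(\alpha+\beta)^{k+1}(g\circ A)^{(n-k)}(z),$$ $$g_R^{(n)}(z)=p_+e^{-(\alpha-\beta)z}\sum_{k=0}^n\binom nk(-1)^k(\alpha-\beta)^{k+1}(g\circ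 A)^{(n-k)}(z).$$ Starting with $a_0$, the higher order derivatives of the composition $g\circ A$ appearing here are computed recursively by Faà di Bruno's formula from the derivatives of $g$ given in the context.
   Context: $K_\nu$ denotes the modified Bessel function of the second kind. The variance gamma distribution with parameters $(\lambda,\alpha,\beta,0)$ has density $$f_T(x)=\frac{\gamma^{2\lambda}}{(2\alpha)^{\lambda-1/2}\sqrt\pi\,\Gamma(\lambda)}|x|^{\lambda-\frac12}K_{\lambda-\frac12}(\alpha|x|)e^{\beta x},\qquad\gamma=\sqrt{\alpha^2-\beta^2},$$ with $F_T(x)=\int_{-\infty}^xf_T(t)\,dt$ and $Q_T=F_T^{-1}$. The base distribution has density $f_B(x)=p_-(\alpha+\beta)e^{(\alpha+\beta)x}$ for $x\le0$ and $f_B(x)=p_+(\alpha-\beta)e^{-(\alpha-\beta)x}$ for $x>0$, and quantile function $$Q_B(u)=\begin{cases}\frac1{\alpha+\beta}\ln\left(\frac u{p_-}\right),&u\le p_-\\-\frac1{\alpha-\beta}\ln\left(\frac{1-u}{p_+}\right),&u>p_-\end{cases}.$$ The left and right problems are the two cases of the equation $dA/dz=f_B(z)/f_T(A(z))$. The function $g$ is $$g(y)=\frac1{f_T(y)}=N_0\frac{e^{-\beta y}|y|^{\frac12-\lambda}}{K_{\lambda-\frac12}(\alpha|y|)},\qquad N_0=\frac{(2\alpha)^{\lambda-1/2}\sqrt\pi\,\Gamma(\lambda)}{\gamma^{2\lambda}}.$$ Its derivatives are $$g^{(n)}(y)=N_0\sum_{k=0}^n\sum_{j=0}^k\binom nk\binom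 kj a^{(n-k)}(y)b^{(j)}(y)c^{(k-j)}(y),$$ where $a(y)=e^{-\beta y}$, $b(y)=|y|^{\frac12-\lambda}$, $c=c_1\circ c_2$ with $c_1(y)=1/y$ and $c_2(y)=K_{\lambda-\frac12}(\alpha|y|)$ (the function $a(y)$ is not to be confused with the coefficients $a_n$), and $$a^{(n)}(y)=(-\beta)^ne^{-\beta y},\qquad b^{(n)}(y)=y^{\frac12-n-\lambda}\prod_{i=0}^{n-1}\left(\tfrac12-\lambda-i\right)\times\begin{cases}+1,&y>0\\-1,&y<0\end{cases},$$ $$c^{(n)}(y)=\sum\frac{n!}{m_1!\cdots m_n!}c_1^{(m_1+\cdots+m_n)}(c_2(y))\prod_{j=1}^n\left(\frac{c_2^{(j)}(y)}{j!}\right)^{m_j},\qquad c_1^{(n)}(y)=(-1)^nn!\,y^{-(n+1)},$$ $$c_2^{(n)}(y)=\left(-\frac\alpha2\right)^n\sum_{k=0}^n\binom nk\times\begin{cases}K_{\lambda-\frac12-(2k-n)}(\alpha y),&y>0\\(-1)^nK_{\lambda-\frac12-(2k-n)}(-\alpha y),&y<0\end{cases},$$ the unindexed sum being over all $(m_1,\dots,m_n)\in\mathbb{Z}_{\ge0}^n$ with $m_1+2m_2+\cdots+nm_n=n$. Faà di Bruno's formula for $g\circ A$ is $(g\circ A)^{(m)}(z)=\sum\frac{m!}{m_1!\cdots m_m!}\,g^{(m_1+\cdots+m_m)}(A(z))\prod_{j=1}^m\left(A^{(j)}(z)/j!\right)^{m_j}$, over all $(m_1,\dots,m_m)\in\mathbb{Z}_{\ge0}^m$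 with $m_1+2m_2+\cdots+m\,m_m=m$, where $A^{(j)}$ is the $(j-1)$-th derivative of $g_L$ (left problem) or $g_R$ (right problem). Superscripts $(n)$ denote $n$-th derivatives.
   Formalization: Coefficients carry the missing factorial: a_n = g_L^{(n-1)}(z_0)/n! and g_R^{(n-1)}(z_0)/n!. For y<0, b^{(n)}(y) is |y|^{1/2-n-λ}∏(1/2-λ-i)·(-1)^n. Where A(z)=0, g(0) is lim 1/f_T and Faà di Bruno holds as a limit, with one-sided derivatives at Q_B(p_-). *)

theory Defs
  imports "HOL-Analysis.Analysis"
begin

text \<open>Modified Bessel function of the second kind, for real order and argument \<open>x > 0\<close>
  (the only arguments that matter below), by its standard integral representation.\<close>
definition bessel_K :: "real \<Rightarrow> real \<Rightarrow> real" where
  "bessel_K \<nu> x = (LBINT t:{0<..}. exp (- x * cosh t) * cosh (\<nu> * t))"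

text \<open>The formula is meaningless at \<open>x = 0\<close>; the value there is irrelevant to the
  distribution function.\<close>
definition vg_density :: "real \<Rightarrow> real \<Rightarrow> real \<Rightarrow> real \<Rightarrow> real" where
  "vg_density lam \<alpha> \<beta> x =
     sqrt (\<alpha>\<^sup>2 - \<beta>\<^sup>2) powr (2 * lam) / ((2 * \<alpha>) powr (lam - 1/2) * sqrt pi * Gamma lam)
     * \<bar>x\<bar> powr (lam - 1/2) * bessel_K (lam - 1/2) (\<alpha> * \<bar>x\<bar>) * exp (\<beta> * x)"

definition vg_cdf :: "real \<Rightarrow> real \<Rightarrow> real \<Rightarrow> real \<Rightarrow> real" where
  "vg_cdf lam \<alpha> \<beta> x = (LBINT t:{..x}. vg_density lam \<alpha> \<beta> t)"

definition vg_quantile :: "real \<Rightarrow> real \<Rightarrow> real \<Rightarrow> real \<Rightarrow> real" where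
  "vg_quantile lam \<alpha> \<beta> = inv (vg_cdf lam \<alpha> \<beta>)"

definition p_minus :: "real \<Rightarrow> real \<Rightarrow> real \<Rightarrow> real" where
  "p_minus lam \<alpha> \<beta> = vg_cdf lam \<alpha> \<beta> 0"

definition p_plus :: "real \<Rightarrow> real \<Rightarrow> real \<Rightarrow> real" where
  "p_plus lam \<alpha> \<beta> = 1 - p_minus lam \<alpha> \<beta>"

definition base_quantile :: "real \<Rightarrow> real \<Rightarrow> real \<Rightarrow> real \<Rightarrow> real" where
  "base_quantile lam \<alpha> \<beta> u =
     (if u \<le> p_minus lam \<alpha> \<beta> then 1 / (\<alpha> + \<beta>) * ln (u / p_minus lam \<alpha> \<beta>)
      else - (1 / (\<alpha> - \<beta>)) * ln ((1 - u) / p_plus lam \<alpha> \<beta>))"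

text \<open>The left problem is imposed up to and including the point where the solution vanishes,
  so \<open>g(0)\<close> is needed. It is the limit, which is finite for every
  \<open>\<lambda> > 0\<close> (it is \<open>0\<close> for \<open>\<lambda> \<le> 1/2\<close>, where the density is unbounded).\<close>
definition vg_g :: "real \<Rightarrow> real \<Rightarrow> real \<Rightarrow> real \<Rightarrow> real" where
  "vg_g lam \<alpha> \<beta> y =
     (if y = 0 then Lim (at 0) (\<lambda>t. 1 / vg_density lam \<alpha> \<beta> t) else 1 / vg_density lam \<alpha> \<beta> y)"


text \<open>The tuples \<open>(m\<^sub>1, \<dots>, m\<^sub>n)\<close> with \<open>m\<^sub>1 + 2 m\<^sub>2 + \<dots> + n m\<^sub>n = n\<close>.\<close>
definition fdb_tuples :: "nat \<Rightarrow> (nat \<Rightarrow> nat) set" where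
  "fdb_tuples n = {m \<in> {1..n} \<rightarrow>\<^sub>E UNIV. (\<Sum>j=1..n. j * m j) = n}"

text \<open>Here \<open>F k\<close> stands for the \<open>k\<close>-th derivative of the outer function at the value of the inner
  function, and \<open>H j\<close> for the \<open>j\<close>-th derivative of the inner function.\<close>
definition faa_di_bruno :: "nat \<Rightarrow> (nat \<Rightarrow> real) \<Rightarrow> (nat \<Rightarrow> real) \<Rightarrow> real" where
  "faa_di_bruno n F H =
     (\<Sum>m\<in>fdb_tuples n. fact n / (\<Prod>j=1..n. fact (m j)) * F (\<Sum>j=1..n. m j)
        * (\<Prod>j=1..n. (H j / fact j) ^ m j))"

definition a_deriv :: "real \<Rightarrow> nat \<Rightarrow> real \<Rightarrow> real" where
  "a_deriv \<beta> n y = (- \<beta>) ^ n * exp (- \<beta> * y)"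

text \<open>For \<open>y < 0\<close> the function \<open>\<bar>y\<bar> powr p\<close> is \<open>(- y) powr p\<close>, whence the absolute value and
  the sign \<open>(- 1) ^ n\<close>.\<close>
definition b_deriv :: "real \<Rightarrow> nat \<Rightarrow> real \<Rightarrow> real" where
  "b_deriv lam n y = \<bar>y\<bar> powr (1/2 - real n - lam) * (\<Prod>i<n. 1/2 - lam - real i)
     * (if y > 0 then 1 else (- 1) ^ n)"

definition c1_deriv :: "nat \<Rightarrow> real \<Rightarrow> real" where
  "c1_deriv n y = (- 1) ^ n * fact n / y ^ (n + 1)"

definition c2_deriv :: "real \<Rightarrow> real \<Rightarrow> nat \<Rightarrow> real \<Rightarrow> real" where
  "c2_deriv lam \<alpha> n y = (- \<alpha> / 2) ^ n * (\<Sum>k\<le>n. real (n choose k) *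
     (if y > 0 then bessel_K (lam - 1/2 - (2 * real k - real n)) (\<alpha> * y)
      else (- 1) ^ n * bessel_K (lam - 1/2 - (2 * real k - real n)) (- \<alpha> * y)))"

definition c_deriv :: "real \<Rightarrow> real \<Rightarrow> nat \<Rightarrow> real \<Rightarrow> real" where
  "c_deriv lam \<alpha> n y =
     faa_di_bruno n (\<lambda>k. c1_deriv k (bessel_K (lam - 1/2) (\<alpha> * \<bar>y\<bar>))) (\<lambda>j. c2_deriv lam \<alpha> j y)"

text \<open>The explicit formula for the \<open>n\<close>-th derivative of \<open>g\<close> at \<open>y \<noteq> 0\<close>.\<close>
definition g_deriv :: "real \<Rightarrow> real \<Rightarrow> real \<Rightarrow> nat \<Rightarrow> real \<Rightarrow> real" where
  "g_deriv lam \<alpha> \<beta> n y =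
     (2 * \<alpha>) powr (lam - 1/2) * sqrt pi * Gamma lam / sqrt (\<alpha>\<^sup>2 - \<beta>\<^sup>2) powr (2 * lam)
     * (\<Sum>k\<le>n. \<Sum>j\<le>k. real (n choose k) * real (k choose j)
          * a_deriv \<beta> (n - k) y * b_deriv lam j y * c_deriv lam \<alpha> (k - j) y)"


text \<open>\<open>n\<close>-th derivative relative to a set: the usual one at interior points, one-sided at an
  end point of an interval.\<close>
definition nth_deriv_within :: "real set \<Rightarrow> nat \<Rightarrow> (real \<Rightarrow> real) \<Rightarrow> real \<Rightarrow> real" where
  "nth_deriv_within S n = (\<lambda>h z. vector_derivative h (at z within S)) ^^ n"

definition g_L :: "real \<Rightarrow> real \<Rightarrow> real \<Rightarrow> (real \<Rightarrow> real) \<Rightarrow> real \<Rightarrow> real" where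
  "g_L lam \<alpha> \<beta> A z =
     p_minus lam \<alpha> \<beta> * (\<alpha> + \<beta>) * exp ((\<alpha> + \<beta>) * z) * vg_g lam \<alpha> \<beta> (A z)"

definition g_R :: "real \<Rightarrow> real \<Rightarrow> real \<Rightarrow> (real \<Rightarrow> real) \<Rightarrow> real \<Rightarrow> real" where
  "g_R lam \<alpha> \<beta> A z =
     p_plus lam \<alpha> \<beta> * (\<alpha> - \<beta>) * exp (- (\<alpha> - \<beta>) * z) * vg_g lam \<alpha> \<beta> (A z)"

text \<open>The domain on which a solution of the left (right) problem lives. The initial point of the
  right problem may be the end point \<open>Q\<^sub>B(p\<^sub>-)\<close>, at which the differential equation
  itself is not imposed.\<close>
definition left_dom :: "real \<Rightarrow> real \<Rightarrow> real \<Rightarrow> real set" where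
  "left_dom lam \<alpha> \<beta> = {..base_quantile lam \<alpha> \<beta> (p_minus lam \<alpha> \<beta>)}"

definition right_dom :: "real \<Rightarrow> real \<Rightarrow> real \<Rightarrow> real \<Rightarrow> real set" where
  "right_dom lam \<alpha> \<beta> u\<^sub>0 =
     insert (base_quantile lam \<alpha> \<beta> u\<^sub>0) {base_quantile lam \<alpha> \<beta> (p_minus lam \<alpha> \<beta>)<..}"

text \<open>\<open>A\<close> solves the left (right) problem on the part of its domain that lies in \<open>N\<close>: everywhere
  for \<open>N = UNIV\<close>, locally for a ball \<open>N\<close> around \<open>z\<^sub>0\<close>.\<close>
definition solves_left ::
  "real \<Rightarrow> real \<Rightarrow> real \<Rightarrow> real \<Rightarrow> real set \<Rightarrow> (real \<Rightarrow> real) \<Rightarrow> bool" where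
  "solves_left lam \<alpha> \<beta> u\<^sub>0 N A \<longleftrightarrow>
     A (base_quantile lam \<alpha> \<beta> u\<^sub>0) = vg_quantile lam \<alpha> \<beta> u\<^sub>0 \<and>
     (\<forall>z\<in>{..base_quantile lam \<alpha> \<beta> (p_minus lam \<alpha> \<beta>)} \<inter> N.
        (A has_real_derivative g_L lam \<alpha> \<beta> A z) (at z within left_dom lam \<alpha> \<beta>))"

definition solves_right ::
  "real \<Rightarrow> real \<Rightarrow> real \<Rightarrow> real \<Rightarrow> real set \<Rightarrow> (real \<Rightarrow> real) \<Rightarrow> bool" where
  "solves_right lam \<alpha> \<beta> u\<^sub>0 N A \<longleftrightarrow>
     A (base_quantile lam \<alpha> \<beta> u\<^sub>0) = vg_quantile lam \<alpha> \<beta> u\<^sub>0 \<and>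
     (\<forall>z\<in>{base_quantile lam \<alpha> \<beta> (p_minus lam \<alpha> \<beta>)<..} \<inter> N.
        (A has_real_derivative g_R lam \<alpha> \<beta> A z) (at z))"

definition has_series_on :: "(real \<Rightarrow> real) \<Rightarrow> (nat \<Rightarrow> real) \<Rightarrow> real \<Rightarrow> real set \<Rightarrow> bool" where
  "has_series_on A a z\<^sub>0 D \<longleftrightarrow> (\<forall>z\<in>D. (\<lambda>n. a n * (z - z\<^sub>0) ^ n) sums A z)"

definition smooth_within :: "real set \<Rightarrow> real set \<Rightarrow> (real \<Rightarrow> real) \<Rightarrow> bool" where
  "smooth_within S D h \<longleftrightarrow>
     (\<forall>n. \<forall>z\<in>D. (nth_deriv_within S n h has_real_derivative nth_deriv_within S (Suc n) h z)
                   (at z within S))"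

text \<open>The right-hand side of Faa di Bruno's formula for \<open>g \<circ> A\<close> when the derivative of
  \<open>A\<close> is \<open>G\<close>, so that the \<open>j\<close>-th derivative of \<open>A\<close> is the \<open>(j - 1)\<close>-st derivative of \<open>G\<close>.\<close>
definition gA_deriv ::
  "real \<Rightarrow> real \<Rightarrow> real \<Rightarrow> real set \<Rightarrow> (real \<Rightarrow> real) \<Rightarrow> (real \<Rightarrow> real) \<Rightarrow> nat \<Rightarrow> real \<Rightarrow> real" where
  "gA_deriv lam \<alpha> \<beta> S A G m z =
     faa_di_bruno m (\<lambda>k. g_deriv lam \<alpha> \<beta> k (A z)) (\<lambda>j. nth_deriv_within S (j - 1) G z)"

text \<open>Faa di Bruno's formula on \<open>D\<close>. The derivatives of \<open>g\<close> exist and are given only away from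
  \<open>0\<close>; where \<open>A\<close> vanishes, which happens at \<open>z\<^sub>0\<close> for \<open>u\<^sub>0 = p\<^sub>-\<close>, the formula holds in the limit.\<close>
definition gA_formula ::
  "real \<Rightarrow> real \<Rightarrow> real \<Rightarrow> real set \<Rightarrow> real set \<Rightarrow> (real \<Rightarrow> real) \<Rightarrow> (real \<Rightarrow> real) \<Rightarrow> bool" where
  "gA_formula lam \<alpha> \<beta> S D A G \<longleftrightarrow>
     (\<forall>m. \<forall>z\<in>D.
        (A z \<noteq> 0 \<longrightarrow>
           nth_deriv_within S m (vg_g lam \<alpha> \<beta> \<circ> A) z = gA_deriv lam \<alpha> \<beta> S A G m z) \<and>
        (A z = 0 \<longrightarrow>
           ((\<lambda>w. gA_deriv lam \<alpha> \<beta> S A G m w) \<longlongrightarrow> nth_deriv_within S m (vg_g lam \<alpha> \<beta> \<circ> A) z)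
             (at z within {w\<in>S. A w \<noteq> 0})))"

end

theory Submission
  imports Defs "HOL-Probability.Probability"
begin

text \<open>
  Writing the density as a Gaussian mixture shows that it integrates to \<open>1\<close> (Tonelli) and that
  its reciprocal \<open>g\<close> extends continuously to \<open>0\<close> (the mixture decreases in \<open>\<bar>x\<bar>\<close>). Hence the
  distribution function is a continuous increasing bijection onto \<open>]0,1[\<close>, and the
  inverse function theorem gives the differential equation for \<open>A = Q\<^sub>T \<circ> Q\<^sub>B\<inverse>\<close>.
  If \<open>A\<close> is a power series near \<open>z\<^sub>0\<close>, it is smooth there, so \<open>A' = c k e\<^bsup>k z\<^esup> g(A)\<close> is smooth, and so is
  \<open>g \<circ> A\<close>, being the quotient of \<open>A'\<close> by \<open>c k e\<^bsup>k z\<^esup>\<close>, even where \<open>g\<close> itself is not smooth.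
  Leibniz' rule then yields the formula for the derivatives of \<open>A'\<close>. Faa di Bruno's formula is
  \<open>n! \<Sum>\<^sub>k F\<^sub>k [t\<^sup>n] h(t)\<^sup>k / k!\<close> by the multinomial theorem; in this form it is differentiated
  term by term.
\<close>

text \<open>The point \<open>z = 0\<close>, where the quantile transform vanishes, shapes the proof.
  It is an admissible initial point of both problems (\<open>u\<^sub>0 = p\<close>), the derivatives
  of \<open>g\<close> may fail to exist at the value \<open>0\<close>, and the domains can end
  there. The chain rule through \<open>g\<close> is therefore available only where
  \<open>A z \<noteq> 0\<close>; at a zero of \<open>A\<close> nothing but the continuity of
  \<open>g\<close> is used. Continuity is enough because it turns a one-sided limit of the
  right-hand side into a one-sided derivative: for the quantile transform at the end of the left
  domain, and for a series solution of the right problem at an initial point where the equation is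
  not imposed.

  Formal power series serve as bookkeeping: differentiating the tuple sum directly would require
  tracking how each tuple changes, whereas coefficients of powers obey an ordinary power rule.

  Differentiating the series \<open>n\<close> times at its centre gives \<open>fact n * a n\<close>,
  which is the source of the factorial in the coefficient formula.\<close>

unbundle no vec_syntax and fps_syntax

subsection \<open>Faa di Bruno's formula\<close>

lemma finite_sum_tuples:
  assumes "finite A"
  shows "finite {m \<in> A \<rightarrow>\<^sub>E (UNIV :: nat set). sum m A = k}"
proof (rule finite_subset)
  show "{m \<in> A \<rightarrow>\<^sub>E (UNIV :: nat set). sum m A = k} \<subseteq> A \<rightarrow>\<^sub>E {..k}"
    using assms by (auto simp: PiE_def Pi_def member_le_sum)
  show "finite (A \<rightarrow>\<^sub>E {..k})"
    using assms by (intro finite_PiE) auto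
qed

text \<open>Divided by \<open>fact k\<close>, the binomial coefficient becomes a product of two
  reciprocal factorials. The statement thus has the same shape for \<open>A\<close> and for the
  remaining exponent \<open>k - i\<close>, and induction on \<open>A\<close> splits off the exponent
  of one index at a time.\<close>

lemma multinomial_fps:
  fixes Y :: "'i \<Rightarrow> real fps"
  assumes "finite A"
  shows "fps_const (1 / fact k) * (\<Sum>j\<in>A. Y j) ^ k =
    (\<Sum>m | m \<in> A \<rightarrow>\<^sub>E UNIV \<and> sum m A = k. \<Prod>j\<in>A. fps_const (1 / fact (m j)) * Y j ^ m j)"
  using assms
proof (induction A arbitrary: k rule: finite_induct)
  case empty
  have "{m. m \<in> {} \<rightarrow>\<^sub>E UNIV \<and> sum m {} = k} = (if k = 0 then {\<lambda>_. undefined} else {} :: ('i \<Rightarrow> nat) set)"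
    by auto
  then show ?case by (cases k) auto
next
  case (insert a A)
  let ?T = "\<lambda>A k. {m. m \<in> A \<rightarrow>\<^sub>E (UNIV :: nat set) \<and> sum m A = k}"
  let ?w = "\<lambda>m j. fps_const (1 / fact (m j)) * Y j ^ m j"
  have fin: "finite (?T A i)" for i
    using finite_sum_tuples[OF insert.hyps(1)] by simp
  have binom: "fps_const (1 / fact k) * of_nat (k choose i) =
      (fps_const (1 / fact i) * fps_const (1 / fact (k - i)) :: real fps)" if "i \<le> k" for i
    using that by (simp add: fps_of_nat[symmetric] binomial_fact)
  have "fps_const (1 / fact k) * (\<Sum>j\<in>insert a A. Y j) ^ k =
      fps_const (1 / fact k) * (\<Sum>i\<le>k. of_nat (k choose i) * Y a ^ i * sum Y A ^ (k - i))"
    using insert.hyps by (simp add: binomial_ring)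
  also have "\<dots> = (\<Sum>i\<le>k. (fps_const (1 / fact k) * of_nat (k choose i)) * Y a ^ i * sum Y A ^ (k - i))"
    by (simp add: sum_distrib_left mult.assoc)
  also have "\<dots> = (\<Sum>i\<le>k. fps_const (1 / fact i) * Y a ^ i *
      (fps_const (1 / fact (k - i)) * sum Y A ^ (k - i)))"
    by (intro sum.cong refl, subst binom) (simp_all only: atMost_iff mult_ac)
  also have "\<dots> = (\<Sum>i\<le>k. \<Sum>m\<in>?T A (k - i). fps_const (1 / fact i) * Y a ^ i * (\<Prod>j\<in>A. ?w m j))"
    by (simp add: insert.IH sum_distrib_left)
  also have "\<dots> = (\<Sum>(i, m)\<in>(SIGMA i:{..k}. ?T A (k - i)).
      fps_const (1 / fact i) * Y a ^ i * (\<Prod>j\<in>A. ?w m j))"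
    by (rule sum.Sigma) (auto simp: fin)
  also have "\<dots> = (\<Sum>m\<in>?T (insert a A) k. \<Prod>j\<in>insert a A. ?w m j)"
  proof (rule sum.reindex_bij_witness[where j = "\<lambda>(i, m). m(a := i)"
        and i = "\<lambda>m. (m a, restrict m A)"])
    fix p assume p: "p \<in> (SIGMA i:{..k}. ?T A (k - i))"
    obtain i m where im: "p = (i, m)" by (cases p)
    have m: "m \<in> A \<rightarrow>\<^sub>E UNIV" "sum m A = k - i" "i \<le> k"
      using p by (auto simp: im)
    have eq: "sum (m(a := i)) A = sum m A" "(\<Prod>j\<in>A. ?w (m(a := i)) j) = (\<Prod>j\<in>A. ?w m j)"
      using insert.hyps by (auto intro!: sum.cong prod.cong)
    show "(case p of (i, m) \<Rightarrow> m(a := i)) \<in> ?T (insert a A) k"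
      using m insert.hyps eq by (auto simp: im PiE_def extensional_def)
    show "((case p of (i, m) \<Rightarrow> m(a := i)) a, restrict (case p of (i, m) \<Rightarrow> m(a := i)) A) = p"
      using m insert.hyps by (auto simp: im PiE_def extensional_def restrict_def fun_eq_iff)
    show "(\<Prod>j\<in>insert a A. ?w (case p of (i, m) \<Rightarrow> m(a := i)) j) =
        (case p of (i, m) \<Rightarrow> fps_const (1 / fact i) * Y a ^ i * (\<Prod>j\<in>A. ?w m j))"
      using insert.hyps eq by (simp add: im)
  next
    fix m assume m: "m \<in> ?T (insert a A) k"
    then show "(case (m a, restrict m A) of (i, m) \<Rightarrow> m(a := i)) = m"
      using insert.hyps by (auto simp: PiE_def extensional_def restrict_def fun_eq_iff)
    show "(m a, restrict m A) \<in> (SIGMA i:{..k}. ?T A (k - i))"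
      using m insert.hyps by (auto simp: PiE_def)
  qed
  finally show ?case .
qed

text \<open>Allows a power series to be cut off after degree \<open>n\<close>, leaving a finite sum
  of monomials to which the multinomial theorem applies.\<close>

lemma fps_power_nth_cong:
  assumes "\<And>i. i \<le> n \<Longrightarrow> f $ i = g $ i"
  shows "(f ^ k) $ n = ((g :: real fps) ^ k) $ n"
proof -
  have "(f ^ k) $ i = (g ^ k) $ i" if "i \<le> n" for i
    using that
  proof (induction k arbitrary: i)
    case (Suc k)
    then show ?case using assms by (auto simp: fps_mult_nth intro!: sum.cong)
  qed simp
  then show ?thesis by simp
qed

lemma prod_fps_const: "(\<Prod>j\<in>A. fps_const (c j)) = fps_const (\<Prod>j\<in>A. c j :: real)"
  by (induction A rule: infinite_finite_induct) auto

text \<open>Exponential generating function without its constant term: the Taylor series of the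
  increment of the inner function. Its \<open>k\<close>-th power therefore starts in degree
  \<open>k\<close>.\<close>

definition egf :: "(nat \<Rightarrow> real) \<Rightarrow> real fps" where
  "egf H = Abs_fps (\<lambda>j. if j = 0 then 0 else H j / fact j)"

text \<open>The tuples are grouped by their total \<open>k\<close>, on which \<open>F\<close>
  depends. The multinomial theorem produces all tuples with total \<open>k\<close>, and extracting
  the coefficient of degree \<open>n\<close> selects those with weighted sum
  \<open>n\<close>.\<close>

lemma faa_di_bruno_conv_fps:
  "faa_di_bruno n F H = fact n * (\<Sum>k\<le>n. F k / fact k * (egf H ^ k) $ n)"
proof -
  let ?T = "\<lambda>k. {m. m \<in> {1..n} \<rightarrow>\<^sub>E (UNIV :: nat set) \<and> sum m {1..n} = k}"
  let ?w = "\<lambda>m. \<Prod>j=1..n. 1 / fact (m j) * (H j / fact j) ^ m j"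
  let ?Y = "\<lambda>j. fps_const (H j / fact j) * fps_X ^ j"
  have fin: "finite (?T k)" for k
    using finite_sum_tuples[of "{1..n}" k] by simp
  have coeff: "1 / fact k * (egf H ^ k) $ n = (\<Sum>m\<in>?T k. if (\<Sum>j=1..n. j * m j) = n then ?w m else 0)"
    for k :: nat
  proof -
    have "(egf H ^ k) $ n = ((\<Sum>j=1..n. ?Y j) ^ k) $ n"
      by (rule fps_power_nth_cong)
        (auto simp: egf_def fps_sum_nth if_distrib cong: if_cong)
    then have "1 / fact k * (egf H ^ k) $ n = (fps_const (1 / fact k) * (\<Sum>j=1..n. ?Y j) ^ k) $ n"
      by simp
    also have "\<dots> = (\<Sum>m\<in>?T k. (\<Prod>j=1..n. fps_const (1 / fact (m j)) * ?Y j ^ m j) $ n)"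
      by (subst multinomial_fps) (auto simp: fps_sum_nth)
    also have "\<dots> = (\<Sum>m\<in>?T k. if (\<Sum>j=1..n. j * m j) = n then ?w m else 0)"
    proof (rule sum.cong[OF refl])
      fix m
      have "(\<Prod>j=1..n. fps_const (1 / fact (m j)) * ?Y j ^ m j) =
          (\<Prod>j=1..n. fps_const (1 / fact (m j) * (H j / fact j) ^ m j) * fps_X ^ (j * m j))"
        by (intro prod.cong refl)
          (simp add: power_mult_distrib power_mult fps_const_power fps_const_mult[symmetric] mult.assoc
            del: fps_const_mult)
      also have "\<dots> = fps_const (?w m) * fps_X ^ (\<Sum>j=1..n. j * m j)"
        by (simp only: prod.distrib prod_fps_const power_sum)
      finally show "(\<Prod>j=1..n. fps_const (1 / fact (m j)) * ?Y j ^ m j) $ n =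
          (if (\<Sum>j=1..n. j * m j) = n then ?w m else 0)"
        by (simp only: fps_mult_left_const_nth fps_X_power_nth) auto
    qed
    finally show ?thesis .
  qed
  have "(\<Sum>k\<le>n. F k / fact k * (egf H ^ k) $ n) =
      (\<Sum>k\<le>n. \<Sum>m\<in>?T k. F k * (if (\<Sum>j=1..n. j * m j) = n then ?w m else 0))"
    by (intro sum.cong refl)
      (simp only: coeff[symmetric] sum_distrib_left[symmetric], simp)
  also have "\<dots> = (\<Sum>(k, m)\<in>(SIGMA k:{..n}. ?T k).
      F k * (if (\<Sum>j=1..n. j * m j) = n then ?w m else 0))"
    using fin by (intro sum.Sigma) (simp_all del: One_nat_def)
  also have "\<dots> = (\<Sum>(k, m)\<in>(SIGMA k:{..n}. {m \<in> ?T k. (\<Sum>j=1..n. j * m j) = n}). F k * ?w m)"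
    using fin by (intro sum.mono_neutral_cong_right) (auto simp del: One_nat_def split: if_splits)
  also have "\<dots> = (\<Sum>m\<in>fdb_tuples n. F (\<Sum>j=1..n. m j) * ?w m)"
  proof (rule sum.reindex_bij_witness[where j = snd and i = "\<lambda>m. (sum m {1..n}, m)"])
    fix m assume m: "m \<in> fdb_tuples n"
    \<comment> \<open>The total never exceeds the weighted sum, which is \<open>n\<close>, so the
      range \<open>k \<le> n\<close> misses no tuple.\<close>
    have "sum m {1..n} \<le> (\<Sum>j=1..n. j * m j)"
      by (intro sum_mono) auto
    then show "(sum m {1..n}, m) \<in> (SIGMA k:{..n}. {m \<in> ?T k. (\<Sum>j=1..n. j * m j) = n})"
      using m by (auto simp: fdb_tuples_def)
  qed (auto simp: fdb_tuples_def)
  also have "fact n * \<dots> = faa_di_bruno n F H"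
    unfolding faa_di_bruno_def sum_distrib_left
    by (intro sum.cong refl)
      (simp add: prod.distrib prod_dividef mult_ac)
  finally show ?thesis by simp
qed

text \<open>Every coefficient of a power is a polynomial in finitely many coefficients, so the power
  rule in the parameter \<open>z\<close> holds coefficientwise while the series variable stays
  formal.\<close>

lemma has_real_derivative_fps_power_nth:
  assumes "\<And>i. ((\<lambda>z. f z $ i) has_real_derivative f' $ i) (at z within S)"
  shows "((\<lambda>z. (f z ^ k) $ n) has_real_derivative (of_nat k * f z ^ (k - 1) * f') $ n) (at z within S)"
proof (induction k arbitrary: n)
  case (Suc k)
  have "((\<lambda>z. \<Sum>i=0..n. f z $ i * (f z ^ k) $ (n - i)) has_real_derivative
      (\<Sum>i=0..n. f z $ i * (of_nat k * f z ^ (k - 1) * f') $ (n - i) + f' $ i * (f z ^ k) $ (n - i)))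
      (at z within S)"
    by (intro DERIV_sum DERIV_mult' assms Suc.IH)
  also have "(\<Sum>i=0..n. f z $ i * (of_nat k * f z ^ (k - 1) * f') $ (n - i) + f' $ i * (f z ^ k) $ (n - i))
      = (f z * (of_nat k * f z ^ (k - 1) * f') + f' * f z ^ k) $ n"
    by (simp add: fps_mult_nth sum.distrib)
  also have "f z * (of_nat k * f z ^ (k - 1) * f') + f' * f z ^ k
      = of_nat (Suc k) * f z ^ (Suc k - 1) * f'"
    by (cases k) (simp_all add: algebra_simps)
  finally show ?case by (simp add: fps_mult_nth)
qed simp

lemma egf_power_nth_eq_0: "n < k \<Longrightarrow> (egf H ^ k) $ n = 0"
  using startsby_zero_power_prefix[of "egf H" k] by (simp add: egf_def)

text \<open>With \<open>h = \<Sum>\<^sub>j H\<^sub>j t\<^sup>j / j!\<close> differentiation of the coefficients turns \<open>h\<close> into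
  \<open>dh/dt - H\<^sub>1\<close>; the terms with \<open>H\<^sub>1\<close> then telescope.\<close>
lemma has_real_derivative_faa_di_bruno:
  assumes F: "\<And>k. ((\<lambda>z. F k z) has_real_derivative F (Suc k) z * H 1 z) (at z within S)"
    and H: "\<And>j. j \<ge> 1 \<Longrightarrow> (H j has_real_derivative H (Suc j) z) (at z within S)"
  shows "((\<lambda>z. faa_di_bruno n (\<lambda>k. F k z) (\<lambda>j. H j z)) has_real_derivative
    faa_di_bruno (Suc n) (\<lambda>k. F k z) (\<lambda>j. H j z)) (at z within S)"
proof -
  define h where "h = (\<lambda>z. egf (\<lambda>j. H j z))"
  define h' where "h' = fps_deriv (h z) - fps_const (H 1 z)"
  define p where "p = (\<lambda>k n. (h z ^ k) $ n)"
  \<comment> \<open>\<open>G (Suc k)\<close> comes from differentiating \<open>F k\<close>, and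
    \<open>- G k\<close> from the \<open>H 1\<close> part of \<open>h'\<close>. The value
    \<open>0\<close> at \<open>k = 0\<close> matches the factor \<open>k\<close> of the power
    rule.\<close>
  define G where "G = (\<lambda>k. if k = 0 then 0 else F k z / fact (k - 1) * (H 1 z * p (k - 1) n))"
  have h: "((\<lambda>z. h z $ i) has_real_derivative h' $ i) (at z within S)" for i
  proof (cases i)
    case (Suc j)
    have "((\<lambda>z. H i z / fact i) has_real_derivative H (Suc i) z / fact i) (at z within S)"
      using H[of i] Suc by (intro DERIV_cdivide) auto
    moreover have "h' $ i = H (Suc i) z / fact i"
      by (simp add: h'_def h_def egf_def Suc divide_simps del: of_nat_Suc)
    ultimately show ?thesis by (simp add: h_def egf_def Suc)
  qed (simp add: h_def h'_def egf_def)
  \<comment> \<open>The formal derivative moves the coefficient of degree \<open>n + 1\<close> to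
    degree \<open>n\<close>; this is how the order of the formula rises to
    \<open>Suc n\<close>.\<close>
  have pow: "(of_nat k * h z ^ (k - 1) * h') $ n =
      real (Suc n) * p k (Suc n) - real k * H 1 z * p (k - 1) n" for k
  proof -
    have "fps_deriv (h z ^ k) = of_nat k * fps_deriv (h z) * h z ^ (k - 1)"
      by (rule fps_deriv_power')
    then have "of_nat k * h z ^ (k - 1) * h' = fps_deriv (h z ^ k) - of_nat k * h z ^ (k - 1) * fps_const (H 1 z)"
      by (simp add: h'_def algebra_simps)
    then show ?thesis
      by (simp add: p_def fps_of_nat[symmetric] mult_ac del: fps_of_nat)
  qed
  have vanish: "p k n = 0" if "n < k" for k n
    using egf_power_nth_eq_0[OF that] by (simp add: p_def h_def)
  have "((\<lambda>z. fact n * (\<Sum>k\<le>n. F k z / fact k * (h z ^ k) $ n)) has_real_derivative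
      fact n * (\<Sum>k\<le>n. F k z / fact k * (of_nat k * h z ^ (k - 1) * h') $ n
        + F (Suc k) z * H 1 z / fact k * (h z ^ k) $ n)) (at z within S)"
    by (intro DERIV_cmult DERIV_sum DERIV_mult' DERIV_cdivide F has_real_derivative_fps_power_nth h)
  also have "(\<lambda>z. fact n * (\<Sum>k\<le>n. F k z / fact k * (h z ^ k) $ n)) =
      (\<lambda>z. faa_di_bruno n (\<lambda>k. F k z) (\<lambda>j. H j z))"
    by (simp add: faa_di_bruno_conv_fps h_def)
  also have "fact n * (\<Sum>k\<le>n. F k z / fact k * (of_nat k * h z ^ (k - 1) * h') $ n
        + F (Suc k) z * H 1 z / fact k * (h z ^ k) $ n)
      = fact n * (\<Sum>k\<le>n. F k z / fact k * (real (Suc n) * p k (Suc n)) + (G (Suc k) - G k))"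
  proof (intro arg_cong2[where f = "(*)"] sum.cong refl)
    fix k
    show "F k z / fact k * (of_nat k * h z ^ (k - 1) * h') $ n + F (Suc k) z * H 1 z / fact k * (h z ^ k) $ n
      = F k z / fact k * (real (Suc n) * p k (Suc n)) + (G (Suc k) - G k)"
    proof (cases k)
      case (Suc j)
      have "real (Suc j) / fact (Suc j) = (1 / fact j :: real)"
        by (simp add: field_simps del: of_nat_Suc)
      then have "F k z / fact k * (real (Suc j) * H 1 z * p j n) = F k z / fact j * (H 1 z * p j n)"
        by (simp add: Suc divide_simps del: of_nat_Suc)
      then show ?thesis
        unfolding pow G_def by (simp add: Suc p_def algebra_simps del: of_nat_Suc fact_Suc)
    qed (unfold pow G_def, simp add: p_def)
  qed
  also have "\<dots> = fact (Suc n) * (\<Sum>k\<le>n. F k z / fact k * p k (Suc n)) + fact n * G (Suc n)"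
  proof -
    have "(\<Sum>k\<le>n. G (Suc k) - G k) = G (Suc n)"
      using sum_lessThan_telescope[of G "Suc n"] by (simp add: lessThan_Suc_atMost G_def)
    then have "(\<Sum>k\<le>n. F k z / fact k * (real (Suc n) * p k (Suc n)) + (G (Suc k) - G k)) =
        (\<Sum>k\<le>n. F k z / fact k * (real (Suc n) * p k (Suc n))) + G (Suc n)"
      by (simp only: sum.distrib)
    also have "(\<Sum>k\<le>n. F k z / fact k * (real (Suc n) * p k (Suc n))) =
        real (Suc n) * (\<Sum>k\<le>n. F k z / fact k * p k (Suc n))"
      by (simp add: sum_distrib_left mult_ac del: of_nat_Suc)
    finally show ?thesis by (simp add: algebra_simps)
  qed
  also have "\<dots> = fact (Suc n) * (\<Sum>k\<le>Suc n. F k z / fact k * p k (Suc n))"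
  proof -
    \<comment> \<open>The boundary term \<open>G (Suc n)\<close> must be the missing summand
      \<open>k = n + 1\<close>. By \<open>pow\<close> this says that \<open>h z ^ n * h'\<close> has
      no coefficient in degree \<open>n\<close>: the power starts in degree \<open>n\<close>, and
      \<open>h'\<close> has no constant term since \<open>H 1\<close> was subtracted.\<close>
    have "real (Suc n) * p (Suc n) (Suc n) = real (Suc n) * (H 1 z * p n n)"
    proof -

      have "(of_nat (Suc n) * h z ^ n * h') $ n = 0"
      proof -
        have "(h z ^ n * h') $ n = (\<Sum>i=0..n. p n i * h' $ (n - i))"
          by (simp add: fps_mult_nth p_def)
        also have "\<dots> = 0"
          by (rule sum.neutral) (use vanish in \<open>auto simp: h'_def h_def egf_def le_less\<close>)
        finally show ?thesis by (simp add: fps_of_nat[symmetric] mult.assoc del: fps_of_nat)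
      qed
      then show ?thesis using pow[of "Suc n"] by (simp add: mult.assoc)
    qed
    then have "p (Suc n) (Suc n) = H 1 z * p n n"
      by (simp del: of_nat_Suc)
    then show ?thesis by (simp add: G_def distrib_left del: fact_Suc)
  qed
  also have "\<dots> = faa_di_bruno (Suc n) (\<lambda>k. F k z) (\<lambda>j. H j z)"
    by (simp only: faa_di_bruno_conv_fps p_def h_def)
  finally show ?thesis .
qed

subsection \<open>The modified Bessel function\<close>

lemma exp_quadratic_eq_normal_density:
  fixes b c t :: real
  assumes "c > 0"
  shows "exp (b * t - c * t\<^sup>2 / 2) =
    sqrt (2 * pi / c) * exp (b\<^sup>2 / (2 * c)) * normal_density (b / c) (1 / sqrt c) t"
proof -
  have "b * t - c * t\<^sup>2 / 2 = b\<^sup>2 / (2 * c) + (- (t - b / c)\<^sup>2 / (2 * (1 / sqrt c)\<^sup>2))"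
    using assms by (simp add: power2_eq_square field_simps)
  then have "exp (b * t - c * t\<^sup>2 / 2) =
      exp (b\<^sup>2 / (2 * c)) * exp (- (t - b / c)\<^sup>2 / (2 * (1 / sqrt c)\<^sup>2))"
    by (simp only: exp_add)
  moreover have "sqrt (2 * pi / c) * (1 / sqrt (2 * pi * (1 / sqrt c)\<^sup>2)) = 1"
    using assms by (simp add: power2_eq_square real_sqrt_divide)
  ultimately show ?thesis
    unfolding normal_density_def by simp
qed

lemma integrable_exp_quadratic:
  fixes b c :: real
  assumes "c > 0"
  shows "integrable lborel (\<lambda>t. exp (b * t - c * t\<^sup>2 / 2))"
  using assms by (simp add: exp_quadratic_eq_normal_density)

lemma nn_integral_exp_quadratic:
  fixes b c :: real
  assumes "c > 0"
  shows "(\<integral>\<^sup>+t. ennreal (exp (b * t - c * t\<^sup>2 / 2)) \<partial>lborel) =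
    ennreal (sqrt (2 * pi / c) * exp (b\<^sup>2 / (2 * c)))"
proof -
  have "(\<integral>t. exp (b * t - c * t\<^sup>2 / 2) \<partial>lborel) = sqrt (2 * pi / c) * exp (b\<^sup>2 / (2 * c))"
    using assms by (simp add: exp_quadratic_eq_normal_density)
  then show ?thesis
    using integrable_exp_quadratic[OF assms, of b] by (simp add: nn_integral_eq_integral)
qed

text \<open>A crude minorant suffices: it gives every Bessel kernel a Gaussian majorant, whatever
  the order \<open>\<nu>\<close>.\<close>

lemma cosh_ge_quadratic: "cosh t \<ge> t\<^sup>2 / 8" for t :: real
proof -
  have "\<bar>t\<bar>\<^sup>2 / 4 \<le> (1 + \<bar>t\<bar> / 2)\<^sup>2"
    by (simp add: power2_eq_square field_simps)
  also have "\<dots> \<le> (exp (\<bar>t\<bar> / 2))\<^sup>2"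
    by (intro power_mono exp_ge_add_one_self) auto
  also have "\<dots> = exp \<bar>t\<bar>"
    by (simp add: exp_double[symmetric])
  also have "\<dots> \<le> 2 * cosh t"
    by (cases "t \<ge> 0") (auto simp: cosh_field_def)
  finally show ?thesis by simp
qed

lemma integrable_bessel_kernel:
  fixes \<nu> x :: real
  assumes "x > 0"
  shows "integrable lborel (\<lambda>t. exp (\<nu> * t - x * cosh t))"
proof (rule Bochner_Integration.integrable_bound)
  show "integrable lborel (\<lambda>t. exp (\<nu> * t - (x / 4) * t\<^sup>2 / 2))"
    using assms by (intro integrable_exp_quadratic) auto
  show "(\<lambda>t. exp (\<nu> * t - x * cosh t)) \<in> borel_measurable lborel"
    by (auto intro!: borel_measurable_continuous_onI continuous_intros)
  have "x * (t\<^sup>2 / 8) \<le> x * cosh t" for t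
    using assms by (intro mult_left_mono cosh_ge_quadratic) auto
  then show "AE t in lborel. norm (exp (\<nu> * t - x * cosh t)) \<le> norm (exp (\<nu> * t - (x / 4) * t\<^sup>2 / 2))"
    by (auto simp: field_simps)
qed

text \<open>Splitting \<open>cosh (\<nu> * t)\<close> into exponentials and reflecting one half
  replaces the half line by the whole line. There the kernel is a single exponential: a shift of the
  order is multiplication by \<open>exp t\<close> or \<open>exp (- t)\<close>, and translations of
  the variable become available.\<close>

lemma bessel_K_eq_integral:
  assumes "x > 0"
  shows "bessel_K \<nu> x = (\<integral>t. exp (\<nu> * t - x * cosh t) \<partial>lborel) / 2"
proof -
  let ?h = "\<lambda>t. exp (\<nu> * t - x * cosh t)"
  have [measurable]: "(cosh :: real \<Rightarrow> real) \<in> borel_measurable borel"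
    by (auto intro!: borel_measurable_continuous_onI continuous_intros)
  have h: "integrable lborel ?h"
    by (rule integrable_bessel_kernel[OF assms])
  have h': "integrable lborel (\<lambda>t. ?h (- t))"
    using integrable_bessel_kernel[OF assms, of "- \<nu>"] by simp
  have i: "integrable lborel (\<lambda>t. indicator A t * ?h t)" "integrable lborel (\<lambda>t. indicator A t * ?h (- t))"
    if "A \<in> sets borel" for A :: "real set"
    using integrable_mult_indicator[OF _ h, of A] integrable_mult_indicator[OF _ h', of A] that by simp_all
  have "(\<integral>t. ?h t \<partial>lborel) = (\<integral>t. indicator {0<..} t * ?h t + indicator {..0} t * ?h t \<partial>lborel)"
    by (rule Bochner_Integration.integral_cong) (auto split: split_indicator)
  also have "\<dots> = (\<integral>t. indicator {0<..} t * ?h t \<partial>lborel) + (\<integral>t. indicator {..0} t * ?h t \<partial>lborel)"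
    by (intro Bochner_Integration.integral_add i) auto
  also have "(\<integral>t. indicator {..0} t * ?h t \<partial>lborel) = (\<integral>t. indicator {..0} (- t) * ?h (- t) \<partial>lborel)"
    using lborel_integral_real_affine[of "-1" "\<lambda>t. indicator {..0} t * ?h t" 0] by simp
  also have "\<dots> = (\<integral>t. indicator {0<..} t * ?h (- t) \<partial>lborel)"
  proof (rule integral_cong_AE)
    show "AE t in lborel. indicator {..0} (- t) * ?h (- t) = indicator {0<..} t * ?h (- t)"
      using AE_lborel_singleton[of "0 :: real"] by eventually_elim (auto split: split_indicator)
  qed measurable
  also have "(\<integral>t. indicator {0<..} t * ?h t \<partial>lborel) + \<dots> =
      (\<integral>t. indicator {0<..} t * ?h t + indicator {0<..} t * ?h (- t) \<partial>lborel)"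
    by (rule Bochner_Integration.integral_add[symmetric]; rule i; simp)
  also have "\<dots> = (\<integral>t. 2 * (indicator {0<..} t *\<^sub>R (exp (- x * cosh t) * cosh (\<nu> * t))) \<partial>lborel)"
  proof (rule Bochner_Integration.integral_cong[OF refl])
    fix t
    have "?h t = exp (- x * cosh t) * exp (\<nu> * t)" "?h (- t) = exp (- x * cosh t) * exp (- (\<nu> * t))"
      by (simp_all add: exp_add[symmetric])
    then have "?h t + ?h (- t) = 2 * (exp (- x * cosh t) * cosh (\<nu> * t))"
      by (simp add: cosh_field_def[of "\<nu> * t"] distrib_left)
    then show "indicator {0<..} t * ?h t + indicator {0<..} t * ?h (- t) =
        2 * (indicator {0<..} t *\<^sub>R (exp (- x * cosh t) * cosh (\<nu> * t)))"
      by (auto split: split_indicator)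
  qed
  also have "\<dots> = 2 * bessel_K \<nu> x"
    by (simp add: bessel_K_def set_lebesgue_integral_def)
  finally show ?thesis by simp
qed

lemma integral_lborel_pos:
  fixes f :: "real \<Rightarrow> real"
  assumes "integrable lborel f" "\<And>t. f t > 0"
  shows "(\<integral>t. f t \<partial>lborel) > 0"
proof -
  have "(\<integral>t. f t \<partial>lborel) \<noteq> 0"
  proof
    assume "(\<integral>t. f t \<partial>lborel) = 0"
    then have "AE t in lborel. f t = 0"
      using assms by (subst (asm) integral_nonneg_eq_0_iff_AE) (auto intro: less_imp_le)
    then have "AE t in (lborel :: real measure). False"
      by eventually_elim (use assms(2) less_irrefl in metis)
    then show False by (auto simp: AE_iff_null dest: null_setsD1)
  qed
  moreover have "(\<integral>t. f t \<partial>lborel) \<ge> 0"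
    using assms(2) by (intro integral_nonneg_AE) (auto intro: less_imp_le)
  ultimately show ?thesis by simp
qed

lemma bessel_K_pos: "x > 0 \<Longrightarrow> bessel_K \<nu> x > 0"
  using integral_lborel_pos[OF integrable_bessel_kernel] by (simp add: bessel_K_eq_integral)

text \<open>Mean value estimate behind the majorant of the difference quotients below.\<close>

lemma abs_exp_diff_le: "\<bar>exp a - exp b\<bar> \<le> \<bar>a - b\<bar> * exp (max a b)" for a b :: real
proof -
  have *: "exp q - exp p \<le> (q - p) * exp q" for p q :: real
  proof -
    have "exp q * (1 + (p - q)) \<le> exp q * exp (p - q)"
      by (intro mult_left_mono exp_ge_add_one_self) auto
    then show ?thesis by (simp add: exp_diff algebra_simps)
  qed
  show ?thesis
    using *[of a b] *[of b a] by (cases "a \<le> b") (auto simp: max_def abs_if)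
qed

text \<open>Differentiation of the kernel brings down \<open>- cosh t\<close>, whose two
  exponentials shift the order down and up by one. Dominated convergence is applied along sequences
  in \<open>{x / 2<..}\<close>, where the kernel at \<open>x / 2\<close> times \<open>cosh t\<close>
  dominates all difference quotients.\<close>

lemma has_real_derivative_bessel_K:
  assumes "x > 0"
  shows "(bessel_K \<nu> has_real_derivative - (bessel_K (\<nu> - 1) x + bessel_K (\<nu> + 1) x) / 2) (at x)"
proof -
  let ?h = "\<lambda>y t. exp (\<nu> * t - y * cosh t)"
  let ?I = "\<lambda>y. \<integral>t. ?h y t \<partial>lborel"
  have cosh_h: "cosh t * ?h y t =
      (exp ((\<nu> - 1) * t - y * cosh t) + exp ((\<nu> + 1) * t - y * cosh t)) / 2" for y t
  proof -
    have "exp ((\<nu> - 1) * t - y * cosh t) = exp (- t) * ?h y t"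
      "exp ((\<nu> + 1) * t - y * cosh t) = exp t * ?h y t"
      by (simp_all add: exp_add[symmetric] algebra_simps)
    then show ?thesis by (simp add: cosh_field_def[of t] algebra_simps)
  qed
  have integrable_cosh_h: "integrable lborel (\<lambda>t. cosh t * ?h y t)" if "y > 0" for y
    unfolding cosh_h using integrable_bessel_kernel[OF that] by simp
  have integral_cosh_h: "(\<integral>t. cosh t * ?h x t \<partial>lborel) = bessel_K (\<nu> - 1) x + bessel_K (\<nu> + 1) x"
    unfolding cosh_h using integrable_bessel_kernel[OF assms] assms
    by (simp add: bessel_K_eq_integral)
  have "(?I has_real_derivative - (\<integral>t. cosh t * ?h x t \<partial>lborel)) (at x within {x / 2<..})"
    unfolding has_field_derivative_iff tendsto_at_iff_sequentially comp_def
  proof (intro allI impI)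
    fix X :: "nat \<Rightarrow> real"
    assume X: "\<forall>i. X i \<in> {x / 2<..} - {x}" "X \<longlonglongrightarrow> x"
    have Xpos: "X i > 0" "X i > x / 2" "X i \<noteq> x" for i
      using X(1)[rule_format, of i] assms by auto
    have "(\<lambda>i. \<integral>t. (?h (X i) t - ?h x t) / (X i - x) \<partial>lborel) \<longlonglongrightarrow> (\<integral>t. - (cosh t * ?h x t) \<partial>lborel)"
    proof (rule integral_dominated_convergence)
      show "(\<lambda>t. - (cosh t * ?h x t)) \<in> borel_measurable lborel"
        by (auto intro!: borel_measurable_continuous_onI continuous_intros)
      show "(\<lambda>t. (?h (X i) t - ?h x t) / (X i - x)) \<in> borel_measurable lborel" for i
        using Xpos[of i] by (auto intro!: borel_measurable_continuous_onI continuous_intros)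
      show "integrable lborel (\<lambda>t. cosh t * ?h (x / 2) t)"
        using assms by (intro integrable_cosh_h) auto
      show "AE t in lborel. (\<lambda>i. (?h (X i) t - ?h x t) / (X i - x)) \<longlonglongrightarrow> - (cosh t * ?h x t)"
      proof (rule AE_I2)
        fix t
        have "((\<lambda>y. ?h y t) has_real_derivative - (cosh t * ?h x t)) (at x)"
          by (auto intro!: derivative_eq_intros)
        then show "(\<lambda>i. (?h (X i) t - ?h x t) / (X i - x)) \<longlonglongrightarrow> - (cosh t * ?h x t)"
          using X by (auto simp: has_field_derivative_iff tendsto_at_iff_sequentially comp_def)
      qed
      show "AE t in lborel. norm ((?h (X i) t - ?h x t) / (X i - x)) \<le> cosh t * ?h (x / 2) t" for i
      proof (rule AE_I2)
        fix t
        have mx: "max (\<nu> * t - X i * cosh t) (\<nu> * t - x * cosh t) \<le> \<nu> * t - x / 2 * cosh t"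
          using Xpos[of i] assms mult_right_mono[of "x / 2" "X i" "cosh t"]
            mult_right_mono[of "x / 2" x "cosh t"] by auto
        have "\<bar>?h (X i) t - ?h x t\<bar> \<le> \<bar>(\<nu> * t - X i * cosh t) - (\<nu> * t - x * cosh t)\<bar> *
            exp (max (\<nu> * t - X i * cosh t) (\<nu> * t - x * cosh t))"
          by (rule abs_exp_diff_le)
        also have "\<dots> \<le> \<bar>(\<nu> * t - X i * cosh t) - (\<nu> * t - x * cosh t)\<bar> * ?h (x / 2) t"
          using mx by (intro mult_left_mono) auto
        also have "\<bar>(\<nu> * t - X i * cosh t) - (\<nu> * t - x * cosh t)\<bar> = \<bar>(x - X i) * cosh t\<bar>"
          by (simp add: algebra_simps)
        also have "\<dots> = \<bar>X i - x\<bar> * cosh t"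
          by (simp add: abs_mult abs_minus_commute)
        finally show "norm ((?h (X i) t - ?h x t) / (X i - x)) \<le> cosh t * ?h (x / 2) t"
          using Xpos[of i] by (simp add: abs_divide field_simps)
      qed
    qed
    moreover have "(\<integral>t. (?h (X i) t - ?h x t) / (X i - x) \<partial>lborel) = (?I (X i) - ?I x) / (X i - x)" for i
      using integrable_bessel_kernel[OF Xpos(1)] integrable_bessel_kernel[OF assms] by simp
    ultimately show "(\<lambda>i. (?I (X i) - ?I x) / (X i - x)) \<longlonglongrightarrow> - (\<integral>t. cosh t * ?h x t \<partial>lborel)"
      by (simp only: Bochner_Integration.integral_minus)
  qed
  then have "(?I has_real_derivative - (\<integral>t. cosh t * ?h x t \<partial>lborel)) (at x)"
    using assms by (subst (asm) at_within_open) auto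
  then have "((\<lambda>y. ?I y / 2) has_real_derivative - (\<integral>t. cosh t * ?h x t \<partial>lborel) / 2) (at x)"
    by (rule DERIV_cdivide)
  then show ?thesis
    unfolding integral_cosh_h
  proof (rule has_field_derivative_transform_within_open)
    show "x \<in> {0<..}" "open {0 :: real<..}" using assms by auto
    show "?I y / 2 = bessel_K \<nu> y" if "y \<in> {0<..}" for y
      using that by (simp add: bessel_K_eq_integral)
  qed
qed

text \<open>Euler's integral after the substitution \<open>t = exp s\<close>; the factor
  \<open>k\<close> is then absorbed by a translation by \<open>ln k\<close>. In this logarithmic
  variable the Gaussian mixture below is written.\<close>

lemma nn_integral_exp_exp:
  fixes lam k :: real
  assumes "lam > 0" "k > 0"
  shows "(\<integral>\<^sup>+s. ennreal (exp (lam * s - k * exp s)) \<partial>lborel) = ennreal (Gamma lam / k powr lam)"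
proof -
  let ?f = "\<lambda>t. t powr (lam - 1) / exp t"
  have range_exp: "range exp = {0 :: real<..}"
    by (auto simp: image_iff) (metis exp_ln)
  have "((\<lambda>t. ?f t) has_integral Gamma lam) {0<..}"
    using Gamma_integral_real[OF assms(1)]
    by (subst has_integral_spike_set_eq[where T = "{0..}"]) (auto intro: negligible_subset[of "{0}"])
  then have "?f absolutely_integrable_on range exp \<and> integral (range exp) ?f = Gamma lam"
    by (auto simp: range_exp has_integral_iff intro!: nonnegative_absolutely_integrable_1)
  then have "(\<lambda>s. \<bar>exp s\<bar> * ?f (exp s)) absolutely_integrable_on UNIV \<and>
      integral UNIV (\<lambda>s. \<bar>exp s\<bar> * ?f (exp s)) = Gamma lam"
    by (subst has_absolute_integral_change_of_variables_1') (auto intro!: DERIV_exp inj_onI)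
  moreover have "\<bar>exp s\<bar> * ?f (exp s) = exp (lam * s - exp s)" for s :: real
    by (simp add: powr_def exp_diff algebra_simps)
  ultimately have "((\<lambda>s. exp (lam * s - exp s)) has_integral Gamma lam) UNIV"
    by (auto simp: has_integral_iff absolutely_integrable_on_def)
  then have "(\<integral>\<^sup>+s. ennreal (exp (lam * s - exp s)) \<partial>lborel) = ennreal (Gamma lam)"
    by (intro nn_integral_has_integral_lborel)
      (auto intro!: borel_measurable_continuous_onI continuous_intros)
  also have "(\<integral>\<^sup>+s. ennreal (exp (lam * s - exp s)) \<partial>lborel) =
      (\<integral>\<^sup>+s. ennreal (exp (lam * (ln k + s) - exp (ln k + s))) \<partial>lborel)"
    by (subst nn_integral_real_affine[where c = 1 and t = "ln k"])
      (auto intro!: borel_measurable_continuous_onI continuous_intros)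
  also have "\<dots> = (\<integral>\<^sup>+s. ennreal (k powr lam) * ennreal (exp (lam * s - k * exp s)) \<partial>lborel)"
    using assms by (intro nn_integral_cong)
      (simp add: ennreal_mult[symmetric] powr_def exp_add exp_diff algebra_simps)
  also have "\<dots> = ennreal (k powr lam) * (\<integral>\<^sup>+s. ennreal (exp (lam * s - k * exp s)) \<partial>lborel)"
    by (rule nn_integral_cmult) (auto intro!: borel_measurable_continuous_onI continuous_intros)
  finally have "ennreal (1 / k powr lam) * ennreal (Gamma lam) =
      ennreal (1 / k powr lam) * ennreal (k powr lam) *
        (\<integral>\<^sup>+s. ennreal (exp (lam * s - k * exp s)) \<partial>lborel)"
    by (simp add: mult.assoc)
  then show ?thesis
    using assms by (simp add: ennreal_mult[symmetric] Gamma_real_pos less_imp_le)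
qed

subsection \<open>The variance gamma distribution\<close>

text \<open>The translation \<open>t = s - ln \<bar>x\<bar>\<close> in the Bessel integral exhibits the density as a
  Gaussian mixture, in which the dependence on \<open>\<bar>x\<bar>\<close> is monotone.\<close>
definition vg_mixture :: "real \<Rightarrow> real \<Rightarrow> real \<Rightarrow> real" where
  "vg_mixture \<nu> \<alpha> x = (\<integral>s. exp (\<nu> * s - \<alpha> / 2 * (exp s + x\<^sup>2 * exp (- s))) \<partial>lborel)"

lemma
  assumes "\<alpha> > 0" "x \<noteq> 0"
  shows integrable_vg_mixture:
      "integrable lborel (\<lambda>s. exp (\<nu> * s - \<alpha> / 2 * (exp s + x\<^sup>2 * exp (- s))))"
    and bessel_K_eq_vg_mixture:
      "\<bar>x\<bar> powr \<nu> * bessel_K \<nu> (\<alpha> * \<bar>x\<bar>) = vg_mixture \<nu> \<alpha> x / 2"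
proof -
  let ?h = "\<lambda>t. exp (\<nu> * t - \<alpha> * \<bar>x\<bar> * cosh t)"
  let ?k = "\<lambda>s. exp (\<nu> * s - \<alpha> / 2 * (exp s + x\<^sup>2 * exp (- s)))"
  have h: "integrable lborel ?h"
    using assms by (intro integrable_bessel_kernel) auto
  have eq: "?h (- ln \<bar>x\<bar> + 1 * s) = \<bar>x\<bar> powr (- \<nu>) * ?k s" for s
  proof -
    have "exp (- ln \<bar>x\<bar> + 1 * s) = exp s / \<bar>x\<bar>" "exp (- (- ln \<bar>x\<bar> + 1 * s)) = \<bar>x\<bar> * exp (- s)"
      using assms by (auto simp: exp_add exp_diff exp_minus field_simps)
    then have "\<alpha> * \<bar>x\<bar> * cosh (- ln \<bar>x\<bar> + 1 * s) = \<alpha> / 2 * (exp s + x\<^sup>2 * exp (- s))"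
      using assms unfolding cosh_field_def by (simp add: field_simps power2_eq_square)
    then have "?h (- ln \<bar>x\<bar> + 1 * s) =
        exp (\<nu> * (- ln \<bar>x\<bar>) + (\<nu> * s - \<alpha> / 2 * (exp s + x\<^sup>2 * exp (- s))))"
      by (simp add: algebra_simps)
    also have "\<dots> = exp (\<nu> * (- ln \<bar>x\<bar>)) * ?k s"
      by (rule exp_add)
    finally show ?thesis
      using assms by (simp add: powr_def)
  qed
  have "integrable lborel (\<lambda>s. \<bar>x\<bar> powr (- \<nu>) * ?k s)"
    using lborel_integrable_real_affine[OF h, of 1 "- ln \<bar>x\<bar>"] unfolding eq by simp
  then show "integrable lborel ?k"
    using assms by simp
  have "(\<integral>t. ?h t \<partial>lborel) = \<bar>x\<bar> powr (- \<nu>) * vg_mixture \<nu> \<alpha> x"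
    using lborel_integral_real_affine[of 1 ?h "- ln \<bar>x\<bar>"] unfolding eq by (simp add: vg_mixture_def)
  then show "\<bar>x\<bar> powr \<nu> * bessel_K \<nu> (\<alpha> * \<bar>x\<bar>) = vg_mixture \<nu> \<alpha> x / 2"
    using assms by (simp add: bessel_K_eq_integral powr_minus)
qed

lemma vg_mixture_pos: "\<alpha> > 0 \<Longrightarrow> x \<noteq> 0 \<Longrightarrow> vg_mixture \<nu> \<alpha> x > 0"
  unfolding vg_mixture_def by (intro integral_lborel_pos integrable_vg_mixture) auto

lemma vg_mixture_antimono:
  assumes "\<alpha> > 0" "x \<noteq> 0" "\<bar>x\<bar> \<le> \<bar>y\<bar>"
  shows "vg_mixture \<nu> \<alpha> y \<le> vg_mixture \<nu> \<alpha> x"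
  unfolding vg_mixture_def
proof (rule integral_mono)
  have "y \<noteq> 0" using assms by auto
  then show "integrable lborel (\<lambda>s. exp (\<nu> * s - \<alpha> / 2 * (exp s + y\<^sup>2 * exp (- s))))"
    using assms by (intro integrable_vg_mixture)
  show "exp (\<nu> * s - \<alpha> / 2 * (exp s + y\<^sup>2 * exp (- s)))
      \<le> exp (\<nu> * s - \<alpha> / 2 * (exp s + x\<^sup>2 * exp (- s)))" for s
  proof -
    have "x\<^sup>2 \<le> y\<^sup>2" using assms(3) by (simp add: abs_le_square_iff)
    then show ?thesis using assms(1) by (auto intro!: mult_left_mono mult_right_mono add_mono)
  qed
qed (use assms in \<open>intro integrable_vg_mixture\<close>)

text \<open>A monotone limit: the reciprocal grows with the modulus of \<open>x\<close> and is
  bounded below by \<open>0\<close>, so its infimum off the origin is the limit. Passing to the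
  reciprocal keeps the limit finite even if the mixture is unbounded.\<close>

lemma tendsto_inverse_vg_mixture:
  assumes "\<alpha> > 0"
  shows "\<exists>L. ((\<lambda>x. 1 / vg_mixture \<nu> \<alpha> x) \<longlongrightarrow> L) (at 0)"
proof
  let ?\<phi> = "\<lambda>x. 1 / vg_mixture \<nu> \<alpha> x"
  have mono: "?\<phi> x \<le> ?\<phi> y" if "x \<noteq> 0" "\<bar>x\<bar> \<le> \<bar>y\<bar>" for x y
    using that assms vg_mixture_antimono[OF assms that] vg_mixture_pos[OF assms, of y]
    by (intro divide_left_mono) (auto intro!: mult_pos_pos vg_mixture_pos)
  have bdd: "bdd_below (?\<phi> ` (- {0}))"
    by (rule bdd_belowI2[where m = 0]) (use vg_mixture_pos[OF assms] in \<open>auto intro: less_imp_le\<close>)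
  show "(?\<phi> \<longlongrightarrow> Inf (?\<phi> ` (- {0}))) (at 0)"
  proof (rule order_tendstoI)
    fix a assume a: "a < Inf (?\<phi> ` (- {0}))"
    have "a < ?\<phi> x" if "x \<noteq> 0" for x
      using cInf_lower[OF _ bdd, of "?\<phi> x"] a that by force
    then show "\<forall>\<^sub>F x in at 0. a < ?\<phi> x"
      by (auto simp: eventually_at_filter)
  next
    fix a assume "Inf (?\<phi> ` (- {0})) < a"
    then obtain y where y: "y \<noteq> 0" "?\<phi> y < a"
      using cInf_lessD[of "?\<phi> ` (- {0})" a] by (auto intro: exI[of _ 1])
    have "?\<phi> x < a" if "x \<noteq> 0" "dist x 0 < \<bar>y\<bar>" for x
      using mono[of x y] that y by auto
    then show "\<forall>\<^sub>F x in at 0. ?\<phi> x < a"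
      unfolding eventually_at using y by (intro exI[of _ "\<bar>y\<bar>"]) auto
  qed
qed

section \<open>The density and its total mass\<close>

locale vg_parameters =
  fixes lam \<alpha> \<beta> :: real
  assumes lam_pos: "lam > 0" and alpha_pos: "\<alpha> > 0" and beta_less: "\<bar>\<beta>\<bar> < \<alpha>"
begin

abbreviation f :: "real \<Rightarrow> real" where "f \<equiv> vg_density lam \<alpha> \<beta>"
abbreviation F :: "real \<Rightarrow> real" where "F \<equiv> vg_cdf lam \<alpha> \<beta>"
abbreviation Q :: "real \<Rightarrow> real" where "Q \<equiv> vg_quantile lam \<alpha> \<beta>"
abbreviation g :: "real \<Rightarrow> real" where "g \<equiv> vg_g lam \<alpha> \<beta>"
abbreviation p :: real where "p \<equiv> p_minus lam \<alpha> \<beta>"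

definition N\<^sub>0 :: real where
  "N\<^sub>0 = (2 * \<alpha>) powr (lam - 1/2) * sqrt pi * Gamma lam / sqrt (\<alpha>\<^sup>2 - \<beta>\<^sup>2) powr (2 * lam)"

lemma gamma_sq_pos: "\<alpha>\<^sup>2 - \<beta>\<^sup>2 > 0"
  using alpha_pos beta_less power_strict_mono[of "\<bar>\<beta>\<bar>" \<alpha> 2] by simp

lemma N0_pos: "N\<^sub>0 > 0"
  using lam_pos alpha_pos gamma_sq_pos by (simp add: N\<^sub>0_def Gamma_real_pos)

lemma f_eq: "f x = \<bar>x\<bar> powr (lam - 1/2) * bessel_K (lam - 1/2) (\<alpha> * \<bar>x\<bar>) * exp (\<beta> * x) / N\<^sub>0"
  by (simp add: vg_density_def N\<^sub>0_def)

lemma f_eq_mixture: "x \<noteq> 0 \<Longrightarrow> f x = vg_mixture (lam - 1/2) \<alpha> x * exp (\<beta> * x) / (2 * N\<^sub>0)"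
  unfolding f_eq by (subst bessel_K_eq_vg_mixture[OF alpha_pos]) auto

text \<open>Since \<open>0 powr s = 0\<close> for every \<open>s\<close>, this is a mere convention
  and says nothing about the limit of the density at the origin.\<close>

lemma f_zero [simp]: "f 0 = 0"
  by (simp add: f_eq)

lemma f_pos: "x \<noteq> 0 \<Longrightarrow> f x > 0"
  using N0_pos alpha_pos by (simp add: f_eq bessel_K_pos)

lemma f_nonneg: "f x \<ge> 0"
  using f_pos[of x] by (cases "x = 0") auto

lemma isCont_f:
  assumes "x \<noteq> 0"
  shows "isCont f x"
proof -
  have "isCont (bessel_K (lam - 1/2)) (\<alpha> * \<bar>x\<bar>)"
    by (rule DERIV_isCont, rule has_real_derivative_bessel_K) (use assms alpha_pos in auto)
  then have "isCont (\<lambda>x. bessel_K (lam - 1/2) (\<alpha> * \<bar>x\<bar>)) x"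
    by (rule isCont_o2[rotated]) (auto intro!: continuous_intros)
  then show ?thesis
    unfolding f_eq[abs_def] using assms N0_pos by (auto intro!: continuous_intros)
qed

lemma f_measurable [measurable]: "f \<in> borel_measurable borel"
  by (rule borel_measurable_continuous_countable_exceptions[where X = "{0}"])
    (auto intro!: continuous_at_imp_continuous_on isCont_f)

text \<open>For a fixed mixing variable \<open>s\<close> the integral over \<open>x\<close> is
  Gaussian; what remains is a Gamma integral in \<open>s\<close>, and its value cancels the
  normalising constant.\<close>

lemma nn_integral_f: "(\<integral>\<^sup>+x. ennreal (f x) \<partial>lborel) = 1"
proof -
  let ?k = "\<lambda>x s. exp ((lam - 1/2) * s - \<alpha> / 2 * exp s) * exp (\<beta> * x - \<alpha> * exp (- s) * x\<^sup>2 / 2)"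
  \<comment> \<open>This is \<open>\<alpha> / 2\<close> minus the contribution of
    \<open>\<beta>\<close> from completing the square; \<open>\<bar>\<beta>\<bar> < \<alpha>\<close>
    makes it positive, so that the Gamma integral converges.\<close>
  let ?c = "(\<alpha>\<^sup>2 - \<beta>\<^sup>2) / (2 * \<alpha>)"
  have c: "?c > 0" using gamma_sq_pos alpha_pos by simp
  have const: "1 / (2 * N\<^sub>0) * (sqrt (2 * pi / \<alpha>) * (Gamma lam / ?c powr lam)) = 1"
  proof -
    have 1: "?c powr lam = (\<alpha>\<^sup>2 - \<beta>\<^sup>2) powr lam / (2 * \<alpha>) powr lam"
      using gamma_sq_pos alpha_pos by (simp add: powr_divide)
    have 2: "sqrt (\<alpha>\<^sup>2 - \<beta>\<^sup>2) powr (2 * lam) = (\<alpha>\<^sup>2 - \<beta>\<^sup>2) powr lam"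
      using gamma_sq_pos by (simp add: powr_half_sqrt[symmetric] powr_powr)
    have 3: "(2 * \<alpha>) powr (lam - 1/2) = (2 * \<alpha>) powr lam / sqrt (2 * \<alpha>)"
      using alpha_pos by (simp add: powr_diff powr_half_sqrt)
    have 4: "sqrt (2 * pi / \<alpha>) * sqrt (2 * \<alpha>) = 2 * sqrt pi"
      using alpha_pos by (simp add: real_sqrt_mult[symmetric] field_simps) (simp add: real_sqrt_mult)
    have 5: "(2 * \<alpha>) powr lam > 0" "(\<alpha>\<^sup>2 - \<beta>\<^sup>2) powr lam > 0" "Gamma lam > 0" "sqrt (2 * \<alpha>) > 0" "sqrt pi > 0"
      using alpha_pos gamma_sq_pos lam_pos by (auto simp: Gamma_real_pos)
    \<comment> \<open>Powers and roots are abstracted to variables, which leaves an identity of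
      rational functions.\<close>
    have cancel: "1 / (2 * (P / T * S * G / R)) * (W * (G / (R / P))) = W * T / (2 * S)"
      if "P > 0" "R > 0" "G > 0" "T > 0" "S > 0" for P R G S T W :: real
      using that by (simp add: field_simps)
    have "1 / (2 * N\<^sub>0) * (sqrt (2 * pi / \<alpha>) * (Gamma lam / ?c powr lam)) =
        sqrt (2 * pi / \<alpha>) * sqrt (2 * \<alpha>) / (2 * sqrt pi)"
      unfolding N\<^sub>0_def 1 2 3 by (rule cancel[OF 5])
    also have "\<dots> = 1" unfolding 4 by simp
    finally show ?thesis .
  qed
  have f_eq': "ennreal (f x) = ennreal (1 / (2 * N\<^sub>0)) * (\<integral>\<^sup>+s. ennreal (?k x s) \<partial>lborel)"
    if "x \<noteq> 0" for x
  proof -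
    have k: "?k x s = exp (\<beta> * x) * exp ((lam - 1/2) * s - \<alpha> / 2 * (exp s + x\<^sup>2 * exp (- s)))" for s
      by (simp add: exp_add[symmetric] algebra_simps)
    have "(\<integral>s. ?k x s \<partial>lborel) = exp (\<beta> * x) * vg_mixture (lam - 1/2) \<alpha> x"
      unfolding k vg_mixture_def by simp
    moreover have "integrable lborel (?k x)"
      unfolding k using integrable_vg_mixture[OF alpha_pos that] by simp
    ultimately have "(\<integral>\<^sup>+s. ennreal (?k x s) \<partial>lborel) = ennreal (exp (\<beta> * x) * vg_mixture (lam - 1/2) \<alpha> x)"
      by (subst nn_integral_eq_integral) auto
    then show ?thesis
      using that N0_pos vg_mixture_pos[OF alpha_pos that, of "lam - 1/2"]
      by (simp add: f_eq_mixture ennreal_mult[symmetric] mult.commute less_imp_le)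
  qed
  have inner: "(\<integral>\<^sup>+x. ennreal (?k x s) \<partial>lborel) =
      ennreal (sqrt (2 * pi / \<alpha>)) * ennreal (exp (lam * s - ?c * exp s))" for s
  proof -
    have "(\<integral>\<^sup>+x. ennreal (?k x s) \<partial>lborel) = ennreal (exp ((lam - 1/2) * s - \<alpha> / 2 * exp s)) *
        (\<integral>\<^sup>+x. ennreal (exp (\<beta> * x - \<alpha> * exp (- s) * x\<^sup>2 / 2)) \<partial>lborel)"
      by (subst nn_integral_cmult[symmetric]) (auto simp: ennreal_mult)
    also have "\<dots> = ennreal (exp ((lam - 1/2) * s - \<alpha> / 2 * exp s)) *
        ennreal (sqrt (2 * pi / (\<alpha> * exp (- s))) * exp (\<beta>\<^sup>2 / (2 * (\<alpha> * exp (- s)))))"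
      using alpha_pos by (subst nn_integral_exp_quadratic) auto
    \<comment> \<open>The Gaussian normalisation contributes \<open>exp (s / 2)\<close>, which
      raises the exponent \<open>lam - 1/2\<close> to \<open>lam\<close>.\<close>
    also have "sqrt (2 * pi / (\<alpha> * exp (- s))) = sqrt (2 * pi / \<alpha>) * exp (s / 2)"
    proof -
      have "2 * pi / (\<alpha> * exp (- s)) = 2 * pi / \<alpha> * (exp (s / 2))\<^sup>2"
        using alpha_pos by (simp add: exp_double[symmetric] exp_minus field_simps)
      then show ?thesis by (simp only: real_sqrt_mult real_sqrt_abs) simp
    qed
    also have "ennreal (exp ((lam - 1/2) * s - \<alpha> / 2 * exp s)) *
        ennreal (sqrt (2 * pi / \<alpha>) * exp (s / 2) * exp (\<beta>\<^sup>2 / (2 * (\<alpha> * exp (- s))))) =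
        ennreal (sqrt (2 * pi / \<alpha>) * exp (((lam - 1/2) * s - \<alpha> / 2 * exp s) + s / 2 + \<beta>\<^sup>2 / (2 * (\<alpha> * exp (- s)))))"
      using alpha_pos by (simp add: ennreal_mult[symmetric] exp_add mult_ac)
    also have "((lam - 1/2) * s - \<alpha> / 2 * exp s) + s / 2 + \<beta>\<^sup>2 / (2 * (\<alpha> * exp (- s))) = lam * s - ?c * exp s"
      using alpha_pos by (simp add: exp_minus field_simps power2_eq_square)
    finally show ?thesis
      using alpha_pos by (simp add: ennreal_mult)
  qed
  have "(\<integral>\<^sup>+x. ennreal (f x) \<partial>lborel) =
      (\<integral>\<^sup>+x. ennreal (1 / (2 * N\<^sub>0)) * (\<integral>\<^sup>+s. ennreal (?k x s) \<partial>lborel) \<partial>lborel)"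
    using AE_lborel_singleton[of "0 :: real"]
    by (intro nn_integral_cong_AE) (auto simp: f_eq' elim: eventually_mono)
  also have "\<dots> = ennreal (1 / (2 * N\<^sub>0)) * (\<integral>\<^sup>+x. \<integral>\<^sup>+s. ennreal (?k x s) \<partial>lborel \<partial>lborel)"
    by (rule nn_integral_cmult) measurable
  also have "(\<integral>\<^sup>+x. \<integral>\<^sup>+s. ennreal (?k x s) \<partial>lborel \<partial>lborel) =
      (\<integral>\<^sup>+s. \<integral>\<^sup>+x. ennreal (?k x s) \<partial>lborel \<partial>lborel)"
    by (rule lborel_pair.Fubini') measurable
  also have "\<dots> = ennreal (sqrt (2 * pi / \<alpha>)) * (\<integral>\<^sup>+s. ennreal (exp (lam * s - ?c * exp s)) \<partial>lborel)"
    unfolding inner by (rule nn_integral_cmult) measurable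
  also have "\<dots> = ennreal (sqrt (2 * pi / \<alpha>) * (Gamma lam / ?c powr lam))"
    unfolding nn_integral_exp_exp[OF lam_pos c] using lam_pos alpha_pos
    by (intro ennreal_mult[symmetric]) (auto simp: Gamma_real_pos less_imp_le)
  also have "ennreal (1 / (2 * N\<^sub>0)) * \<dots> = ennreal (1 / (2 * N\<^sub>0) * (sqrt (2 * pi / \<alpha>) * (Gamma lam / ?c powr lam)))"
    using N0_pos lam_pos alpha_pos by (intro ennreal_mult[symmetric]) (auto simp: Gamma_real_pos less_imp_le)
  also have "\<dots> = 1"
    unfolding const by simp
  finally show ?thesis .
qed

section \<open>The distribution function and its inverse\<close>

lemma integrable_f: "integrable lborel f"
  using nn_integral_f f_nonneg by (auto simp: integrable_iff_bounded)

text \<open>Gives access to the general theory of distribution functions: limits at infinity,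
  bounds, and continuity as absence of atoms.\<close>

definition M :: "real measure" where
  "M = density lborel (\<lambda>x. ennreal (f x))"

lemma real_distribution_M: "real_distribution M"
proof -
  interpret prob_space M
    by standard (simp add: M_def emeasure_density nn_integral_f)
  show ?thesis
    by standard (simp_all add: M_def)
qed

lemma cdf_M: "cdf M x = F x"
proof -
  have "emeasure M {..x} = (\<integral>\<^sup>+t. ennreal (indicator {..x} t * f t) \<partial>lborel)"
    unfolding M_def by (subst emeasure_density)
      (auto intro!: nn_integral_cong split: split_indicator)
  also have "\<dots> = ennreal (F x)"
    unfolding vg_cdf_def set_lebesgue_integral_def real_scaleR_def
    using integrable_mult_indicator[OF _ integrable_f, of "{..x}"] f_nonneg
    by (intro nn_integral_eq_integral) (auto split: split_indicator)
  finally show ?thesis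
    using f_nonneg
    by (simp add: cdf_def measure_def vg_cdf_def set_lebesgue_integral_def integral_nonneg_AE)
qed

lemma isCont_F: "isCont F x"
proof -
  interpret real_distribution M by (rule real_distribution_M)
  have "emeasure M {x} = (\<integral>\<^sup>+t. ennreal (f t) * indicator {x} t \<partial>lborel)"
    unfolding M_def by (rule emeasure_density) auto
  also have "\<dots> = (\<integral>\<^sup>+t. 0 \<partial>(lborel :: real measure))"
    by (rule nn_integral_cong_AE, rule eventually_mono[OF AE_lborel_singleton[of x]])
      (auto split: split_indicator)
  finally have "measure M {x} = 0" by (simp add: measure_def)
  moreover have "cdf M = F" using cdf_M by blast
  ultimately show ?thesis using isCont_cdf[of x] by simp
qed

lemma F_at_top: "(F \<longlongrightarrow> 1) at_top" and F_at_bot: "(F \<longlongrightarrow> 0) at_bot"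
proof -
  interpret real_distribution M by (rule real_distribution_M)
  have "cdf M = F" using cdf_M by blast
  then show "(F \<longlongrightarrow> 1) at_top" "(F \<longlongrightarrow> 0) at_bot"
    using cdf_lim_at_top_prob cdf_lim_at_bot by simp_all
qed

lemma F_eq_integral:
  assumes "a \<le> y"
  shows "F y = F a + integral {a..y} f"
proof -
  have int: "set_integrable lborel A f" if "A \<in> sets borel" for A
    using integrable_mult_indicator[OF _ integrable_f, of A] that by (simp add: set_integrable_def)
  have "{..y} = {..a} \<union> {a<..y}" using assms by auto
  then have "F y = F a + (LBINT t:{a<..y}. f t)"
    unfolding vg_cdf_def by (simp only:) (rule set_integral_Un, auto intro!: int)
  also have "(LBINT t:{a<..y}. f t) = integral {a<..y} f"
    by (intro set_borel_integral_eq_integral int) auto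
  also have "\<dots> = integral {a..y} f"
    by (rule integral_spike_set) (auto intro: negligible_subset[of "{a}"])
  finally show ?thesis .
qed

lemma has_real_derivative_F:
  assumes "x \<noteq> 0"
  shows "(F has_real_derivative f x) (at x)"
proof -
  \<comment> \<open>Half the distance to the origin keeps the interval inside the region where the
    density is continuous.\<close>
  define a where "a = x - \<bar>x\<bar> / 2"
  define b where "b = x + \<bar>x\<bar> / 2"
  have ab: "a < x" "x < b" "0 \<notin> {a..b}"
    using assms by (auto simp: a_def b_def abs_if split: if_splits)
  have "((\<lambda>y. integral {a..y} f) has_real_derivative f x) (at x within {a..b})"
    using ab by (intro integral_has_real_derivative continuous_at_imp_continuous_on ballI isCont_f) auto
  then have "((\<lambda>y. integral {a..y} f) has_real_derivative f x) (at x)"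
    using ab by (subst (asm) at_within_interior) auto
  then have "((\<lambda>y. F a + integral {a..y} f) has_real_derivative f x) (at x)"
    by (auto intro!: derivative_eq_intros)
  then show ?thesis
  proof (rule has_field_derivative_transform_within_open)
    show "F a + integral {a..y} f = F y" if "y \<in> {a<..}" for y
      using that by (intro F_eq_integral[symmetric]) auto
  qed (use ab in auto)
qed

text \<open>The derivative is known to be positive only off the origin. An interval with
  \<open>0\<close> inside is cut there, and continuity of \<open>F\<close> up to the end points
  handles both pieces.\<close>

lemma strict_mono_F: "strict_mono F"
proof (rule strict_monoI)
  have step: "F a < F b" if "a < b" "\<And>x. a < x \<Longrightarrow> x < b \<Longrightarrow> x \<noteq> 0" for a b
    using that
    by (intro DERIV_pos_imp_increasing_open[of a b F])
      (auto intro!: exI[of _ "f _"] has_real_derivative_F f_pos continuous_at_imp_continuous_on isCont_F)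
  fix a b :: real assume "a < b"
  show "F a < F b"
  proof (cases "a < 0 \<and> 0 < b")
    case True
    then show ?thesis using step[of a 0] step[of 0 b] by force
  next
    case False
    then show ?thesis using step[OF \<open>a < b\<close>] by force
  qed
qed

lemma F_gt_0: "F x > 0" and F_less_1: "F x < 1"
proof -
  interpret real_distribution M by (rule real_distribution_M)
  have "F (x - 1) < F x" "F x < F (x + 1)"
    using strict_mono_F by (auto simp: strict_mono_def)
  moreover have "F (x - 1) \<ge> 0" "F (x + 1) \<le> 1"
    using cdf_nonneg cdf_bounded_prob by (auto simp: cdf_M[symmetric])
  ultimately show "F x > 0" "F x < 1" by linarith+
qed

lemma Q_F [simp]: "Q (F x) = x"
  unfolding vg_quantile_def using strict_mono_F by (intro inv_f_f strict_mono_imp_inj_on)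

lemma F_surj:
  assumes "u \<in> {0<..<1}"
  obtains x where "F x = u"
proof -
  have "\<forall>\<^sub>F x in at_bot. F x < u" "\<forall>\<^sub>F x in at_top. u < F x"
    using F_at_bot F_at_top assms by (auto dest: order_tendstoD)
  then obtain a b where a: "\<And>x. x \<le> a \<Longrightarrow> F x < u" and b: "\<And>x. x \<ge> b \<Longrightarrow> u < F x"
    by (auto simp: eventually_at_bot_linorder eventually_at_top_linorder)
  have "F (min a b) \<le> u" "u \<le> F (max a b)"
    using a[of "min a b"] b[of "max a b"] by auto
  then have "\<exists>x. min a b \<le> x \<and> x \<le> max a b \<and> F x = u"
    by (intro IVT) (auto intro: isCont_F)
  then show ?thesis using that by blast
qed

lemma F_Q [simp]: "u \<in> {0<..<1} \<Longrightarrow> F (Q u) = u"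
  using F_surj[of u] Q_F by metis

lemma isCont_Q:
  assumes "u \<in> {0<..<1}"
  shows "isCont Q u"
proof -
  have "isCont Q (F (Q u))"
    by (rule isCont_inverse_function2[of "Q u - 1" _ "Q u + 1"]) (auto intro: isCont_F)
  then show ?thesis using assms by simp
qed

lemma has_real_derivative_Q:
  assumes "u \<in> {0<..<1}" "Q u \<noteq> 0"
  shows "(Q has_real_derivative inverse (f (Q u))) (at u)"
  by (rule DERIV_inverse_function[where f = F and a = 0 and b = 1])
    (use assms f_pos[of "Q u"] in \<open>auto intro!: has_real_derivative_F isCont_Q\<close>)

lemma p_bounds: "p > 0" "p < 1"
  by (auto simp: p_minus_def F_gt_0 F_less_1)

lemma Q_p [simp]: "Q p = 0"
  by (simp add: p_minus_def)

text \<open>\<open>Lim\<close> is meaningful only if a limit exists; here the value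
  \<open>g 0\<close> is shown to be a genuine one.\<close>

lemma inverse_f_tendsto_0: "((\<lambda>t. 1 / f t) \<longlongrightarrow> g 0) (at 0)"
proof -
  obtain L where L: "((\<lambda>x. 1 / vg_mixture (lam - 1/2) \<alpha> x) \<longlongrightarrow> L) (at 0)"
    using tendsto_inverse_vg_mixture[OF alpha_pos] by blast
  have "((\<lambda>x. 2 * N\<^sub>0 * exp (- \<beta> * x) * (1 / vg_mixture (lam - 1/2) \<alpha> x)) \<longlongrightarrow> 2 * N\<^sub>0 * exp (- \<beta> * 0) * L) (at 0)"
    by (intro tendsto_intros L)
  then have lim: "((\<lambda>t. 1 / f t) \<longlongrightarrow> 2 * N\<^sub>0 * exp (- \<beta> * 0) * L) (at 0)"
    by (rule Lim_transform_eventually)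
      (auto simp: eventually_at_filter f_eq_mixture exp_minus field_simps)
  moreover have "g 0 = 2 * N\<^sub>0 * exp (- \<beta> * 0) * L"
    unfolding vg_g_def using tendsto_Lim[OF _ lim] by simp
  ultimately show ?thesis by simp
qed

lemma isCont_g: "isCont g y"
proof (cases "y = 0")
  case True
  have "(g \<longlongrightarrow> g 0) (at 0)"
    by (rule Lim_transform_eventually[OF inverse_f_tendsto_0]) (auto simp: eventually_at_filter vg_g_def)
  then show ?thesis using True by (simp add: isCont_def)
next
  case False
  have "isCont (\<lambda>y. 1 / f y) y"
    using False f_pos[OF False] by (intro continuous_intros isCont_f) auto
  moreover have "\<forall>\<^sub>F t in nhds y. 1 / f t = g t"
    using t1_space_nhds[OF False] by eventually_elim (simp add: vg_g_def)
  ultimately show ?thesis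
    by (subst (asm) isCont_cong)
qed

end

subsection \<open>Higher derivatives\<close>

text \<open>A tower of derivatives given by explicit formulas. Kept apart from
  \<open>nth_deriv_within\<close>, it can be checked one step at a time and combined by sums,
  products and composition; uniqueness of derivatives identifies the two afterwards.\<close>

definition derivs_on :: "real set \<Rightarrow> real set \<Rightarrow> (nat \<Rightarrow> real \<Rightarrow> real) \<Rightarrow> bool" where
  "derivs_on S D q \<longleftrightarrow> (\<forall>n. \<forall>z\<in>D. (q n has_real_derivative q (Suc n) z) (at z within S))"

lemma derivs_onD: "derivs_on S D q \<Longrightarrow> z \<in> D \<Longrightarrow> (q n has_real_derivative q (Suc n) z) (at z within S)"
  by (simp add: derivs_on_def)

lemma has_real_derivative_cong_openin:
  assumes "(q has_real_derivative y) (at z within S)" "openin (top_of_set S) D" "z \<in> D"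
    and "\<And>w. w \<in> D \<Longrightarrow> h w = q w"
  shows "(h has_real_derivative y) (at z within S)"
proof -
  have "D \<subseteq> S" "\<forall>x\<in>D. \<exists>e>0. ball x e \<inter> S \<subseteq> D"
    using assms(2) by (auto simp: openin_contains_ball)
  with assms(3) obtain e where e: "e > 0" "ball z e \<inter> S \<subseteq> D" and z: "z \<in> S"
    by blast
  show ?thesis
  proof (rule has_field_derivative_transform_within[OF assms(1) e(1) z])
    show "q w = h w" if "w \<in> S" "dist w z < e" for w
    proof -
      have "w \<in> D" using that e(2) by (auto simp: dist_commute)
      then show ?thesis using assms(4) by simp
    qed
  qed
qed

lemma nth_deriv_within_0 [simp]: "nth_deriv_within S 0 h = h"
  by (simp add: nth_deriv_within_def)

text \<open>The induction carries the identity on all of \<open>D\<close>, since a derivative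
  depends on nearby values; relative openness keeps these in \<open>D\<close>. Non-trivial filters
  make \<open>vector_derivative\<close> well determined.\<close>

lemma nth_deriv_within_eq:
  assumes "derivs_on S D q" "openin (top_of_set S) D" "\<And>z. z \<in> D \<Longrightarrow> at z within S \<noteq> bot"
    and "\<And>z. z \<in> D \<Longrightarrow> h z = q 0 z" and "z \<in> D"
  shows "nth_deriv_within S n h z = q n z"
  using assms(5)
proof (induction n arbitrary: z)
  case 0
  then show ?case using assms(4) by (simp add: nth_deriv_within_def)
next
  case (Suc n)
  have "(nth_deriv_within S n h has_real_derivative q (Suc n) z) (at z within S)"
    using has_real_derivative_cong_openin[OF derivs_onD[OF assms(1) Suc.prems] assms(2) Suc.prems] Suc.IH
    by blast
  then have "vector_derivative (nth_deriv_within S n h) (at z within S) = q (Suc n) z"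
    using assms(3)[OF Suc.prems]
    by (intro vector_derivative_within) (simp_all add: has_real_derivative_iff_has_vector_derivative)
  then show ?case by (simp add: nth_deriv_within_def)
qed

lemma smooth_withinI:
  assumes "derivs_on S D q" "openin (top_of_set S) D" "\<And>z. z \<in> D \<Longrightarrow> at z within S \<noteq> bot"
    and "\<And>z. z \<in> D \<Longrightarrow> h z = q 0 z"
  shows "smooth_within S D h"
  unfolding smooth_within_def
proof (intro allI ballI)
  fix n z assume z: "z \<in> D"
  have eq: "nth_deriv_within S n h w = q n w" if "w \<in> D" for n w
    using nth_deriv_within_eq[OF assms that] .
  show "(nth_deriv_within S n h has_real_derivative nth_deriv_within S (Suc n) h z) (at z within S)"
    using has_real_derivative_cong_openin[OF derivs_onD[OF assms(1) z] assms(2) z] eq z by metis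
qed

text \<open>Pascal's rule in summed form, the induction step shared by Leibniz' rule and the
  iterated Bessel recurrence.\<close>

lemma sum_binomial_Suc:
  "(\<Sum>k\<le>n. real (n choose k) * (u k + u (Suc k))) = (\<Sum>k\<le>Suc n. real (Suc n choose k) * u k)"
proof -
  have "(\<Sum>k\<le>n. real (n choose k) * u k) = (\<Sum>k\<le>Suc n. real (n choose k) * u k)"
    by simp
  also have "\<dots> = u 0 + (\<Sum>k\<le>n. real (n choose Suc k) * u (Suc k))"
    by (subst sum.atMost_Suc_shift) simp
  finally have "(\<Sum>k\<le>n. real (n choose k) * (u k + u (Suc k))) =
      u 0 + (\<Sum>k\<le>n. real (n choose Suc k) * u (Suc k)) + (\<Sum>k\<le>n. real (n choose k) * u (Suc k))"
    by (simp add: distrib_left sum.distrib)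
  also have "\<dots> = u 0 + (\<Sum>k\<le>n. real (Suc n choose Suc k) * u (Suc k))"
    by (simp add: sum.distrib[symmetric] algebra_simps)
  also have "\<dots> = (\<Sum>k\<le>Suc n. real (Suc n choose k) * u k)"
    by (subst sum.atMost_Suc_shift) simp
  finally show ?thesis .
qed

lemma derivs_on_mult:
  assumes "derivs_on S D a" "derivs_on S D b"
  shows "derivs_on S D (\<lambda>n z. \<Sum>k\<le>n. real (n choose k) * (a (n - k) z * b k z))"
  unfolding derivs_on_def
proof (intro allI ballI)
  fix n z assume z: "z \<in> D"
  have "((\<lambda>z. \<Sum>k\<le>n. real (n choose k) * (a (n - k) z * b k z)) has_real_derivative
      (\<Sum>k\<le>n. real (n choose k) * (a (n - k) z * b (Suc k) z + a (Suc (n - k)) z * b k z))) (at z within S)"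
    by (intro DERIV_sum DERIV_cmult DERIV_mult' derivs_onD[OF assms(1) z] derivs_onD[OF assms(2) z])
  also have "(\<Sum>k\<le>n. real (n choose k) * (a (n - k) z * b (Suc k) z + a (Suc (n - k)) z * b k z)) =
      (\<Sum>k\<le>n. real (n choose k) * (a (Suc n - k) z * b k z + a (Suc n - Suc k) z * b (Suc k) z))"
    by (intro sum.cong refl) (simp add: Suc_diff_le)
  also have "\<dots> = (\<Sum>k\<le>Suc n. real (Suc n choose k) * (a (Suc n - k) z * b k z))"
    by (rule sum_binomial_Suc)
  finally show "((\<lambda>z. \<Sum>k\<le>n. real (n choose k) * (a (n - k) z * b k z)) has_real_derivative
      (\<Sum>k\<le>Suc n. real (Suc n choose k) * (a (Suc n - k) z * b k z))) (at z within S)" .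
qed

lemma derivs_on_cmult: "derivs_on S D a \<Longrightarrow> derivs_on S D (\<lambda>n z. c * a n z)"
  by (auto simp: derivs_on_def intro: DERIV_cmult)

lemma derivs_on_exp: "derivs_on S D (\<lambda>n z. k ^ n * exp (k * z))"
  by (auto simp: derivs_on_def intro!: derivative_eq_intros)

section \<open>Explicit derivatives of the factors of \<open>g\<close>\<close>

lemma derivs_on_a_deriv: "derivs_on S D (a_deriv \<beta>)"
  using derivs_on_exp[of S D "- \<beta>"] by (simp add: a_deriv_def[abs_def])

lemma derivs_on_b_deriv: "derivs_on UNIV (- {0}) (b_deriv lam)"
  unfolding derivs_on_def
proof (intro allI ballI)
  fix n and y :: real assume y: "y \<in> - {0}"
  let ?P = "\<lambda>n. \<Prod>i<n. 1/2 - lam - real i"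
  let ?e = "1/2 - real n - lam"
  have e: "1/2 - real (Suc n) - lam = ?e - 1" and P: "?P (Suc n) = ?P n * ?e"
    by simp_all
  show "(b_deriv lam n has_real_derivative b_deriv lam (Suc n) y) (at y)"
  proof (cases "y > 0")
    case True
    have "((\<lambda>y. y powr ?e * ?P n) has_real_derivative ?e * y powr (?e - 1) * ?P n) (at y)"
      using True by (auto intro!: derivative_eq_intros)
    also have "?e * y powr (?e - 1) * ?P n = b_deriv lam (Suc n) y"
      unfolding b_deriv_def e P using True by simp
    finally show ?thesis
      by (rule has_field_derivative_transform_within_open[where S = "{0<..}"])
        (use True in \<open>auto simp: b_deriv_def\<close>)
  next
    case False
    with y have "y < 0" by simp
    \<comment> \<open>On the negative half line each differentiation contributes the inner
      derivative \<open>- 1\<close>, whence the sign \<open>(- 1) ^ n\<close>.\<close>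
    have "((\<lambda>y. (- y) powr ?e * ?P n * (- 1) ^ n) has_real_derivative
        - (?e * (- y) powr (?e - 1)) * ?P n * (- 1) ^ n) (at y)"
      using \<open>y < 0\<close> by (auto intro!: derivative_eq_intros)
    also have "- (?e * (- y) powr (?e - 1)) * ?P n * (- 1) ^ n = b_deriv lam (Suc n) y"
      unfolding b_deriv_def e P using \<open>y < 0\<close> by simp
    finally show ?thesis
      by (rule has_field_derivative_transform_within_open[where S = "{..<0}"])
        (use \<open>y < 0\<close> in \<open>auto simp: b_deriv_def\<close>)
  qed
qed

lemma has_real_derivative_c1_deriv:
  assumes "x \<noteq> 0"
  shows "(c1_deriv n has_real_derivative c1_deriv (Suc n) x) (at x)"
proof -
  have "((\<lambda>x. x ^ (n + 1)) has_real_derivative real (n + 1) * x ^ n) (at x)"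
    using DERIV_pow[of "n + 1" x] by simp
  then have A: "((\<lambda>x. (- 1) ^ n * fact n * inverse (x ^ (n + 1))) has_real_derivative
      (- 1) ^ n * fact n * (- (real (n + 1) * x ^ n * inverse ((x ^ (n + 1)) ^ Suc (Suc 0))))) (at x)"
    using assms by (intro DERIV_cmult DERIV_inverse_fun) auto
  have B: "(- 1) ^ n * fact n * (- (real (n + 1) * x ^ n * inverse ((x ^ (n + 1)) ^ Suc (Suc 0))))
      = c1_deriv (Suc n) x"
    using assms by (simp add: c1_deriv_def field_simps)
  have C: "c1_deriv n = (\<lambda>x. (- 1) ^ n * fact n * inverse (x ^ (n + 1)))"
    by (simp add: c1_deriv_def fun_eq_iff divide_inverse)
  show ?thesis
    using A unfolding B C .
qed

text \<open>A factor \<open>k\<close> of either sign covers both half lines: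
  \<open>k = \<alpha>\<close> for \<open>y > 0\<close> and \<open>k = - \<alpha>\<close> for
  \<open>y < 0\<close>. The Bessel recurrence sends the term \<open>i\<close> of level
  \<open>n\<close> to the terms \<open>i\<close> and \<open>Suc i\<close> of level
  \<open>Suc n\<close>, the pattern of \<open>sum_binomial_Suc\<close>.\<close>

lemma has_real_derivative_bessel_K_sum:
  assumes "k * y > 0"
  shows "((\<lambda>y. (- k / 2) ^ n * (\<Sum>i\<le>n. real (n choose i) * bessel_K (\<nu> - (2 * real i - real n)) (k * y)))
    has_real_derivative (- k / 2) ^ Suc n *
      (\<Sum>i\<le>Suc n. real (Suc n choose i) * bessel_K (\<nu> - (2 * real i - real (Suc n))) (k * y))) (at y)"
proof -
  let ?u = "\<lambda>i. bessel_K (\<nu> - (2 * real i - real (Suc n))) (k * y)"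
  let ?\<mu> = "\<lambda>i. \<nu> - (2 * real i - real n)"
  have "((\<lambda>y. bessel_K (?\<mu> i) (k * y)) has_real_derivative - k / 2 * (?u i + ?u (Suc i))) (at y)" for i
  proof -
    have "((\<lambda>y. bessel_K (?\<mu> i) (k * y)) has_real_derivative
        - (bessel_K (?\<mu> i - 1) (k * y) + bessel_K (?\<mu> i + 1) (k * y)) / 2 * k) (at y)"
      by (rule DERIV_chain2[where f = "bessel_K (?\<mu> i)"], rule has_real_derivative_bessel_K[OF assms])
        (auto intro!: derivative_eq_intros)
    moreover have "?\<mu> i - 1 = \<nu> - (2 * real (Suc i) - real (Suc n))"
      "?\<mu> i + 1 = \<nu> - (2 * real i - real (Suc n))"
      by simp_all
    ultimately have "((\<lambda>y. bessel_K (?\<mu> i) (k * y)) has_real_derivative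
        - (?u (Suc i) + ?u i) / 2 * k) (at y)"
      by (simp only:)
    moreover have "- (v + u) / 2 * k = - k / 2 * (u + v)" for u v :: real
      by (simp add: field_simps)
    ultimately show ?thesis by (simp only:)
  qed
  then have "((\<lambda>y. (- k / 2) ^ n * (\<Sum>i\<le>n. real (n choose i) * bessel_K (?\<mu> i) (k * y)))
      has_real_derivative (- k / 2) ^ n * (\<Sum>i\<le>n. real (n choose i) * (- k / 2 * (?u i + ?u (Suc i))))) (at y)"
    by (intro DERIV_cmult DERIV_sum)
  also have "(\<Sum>i\<le>n. real (n choose i) * (- k / 2 * (?u i + ?u (Suc i)))) =
      - k / 2 * (\<Sum>i\<le>n. real (n choose i) * (?u i + ?u (Suc i)))"
    unfolding sum_distrib_left by (intro sum.cong refl) (simp only: mult_ac)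
  also have "(\<Sum>i\<le>n. real (n choose i) * (?u i + ?u (Suc i))) = (\<Sum>i\<le>Suc n. real (Suc n choose i) * ?u i)"
    by (rule sum_binomial_Suc)
  finally show ?thesis by (simp only: power_Suc2 mult.assoc)
qed

lemma derivs_on_c2_deriv:
  assumes "\<alpha> > 0"
  shows "derivs_on UNIV (- {0}) (c2_deriv lam \<alpha>)"
  unfolding derivs_on_def
proof (intro allI ballI)
  fix n and y :: real assume y: "y \<in> - {0}"
  let ?d = "\<lambda>k n y. (- k / 2) ^ n * (\<Sum>i\<le>n. real (n choose i) * bessel_K (lam - 1/2 - (2 * real i - real n)) (k * y))"
  have pos: "c2_deriv lam \<alpha> n y = ?d \<alpha> n y" if "y > 0" for n y
    using that by (simp add: c2_deriv_def)
  have neg: "c2_deriv lam \<alpha> n y = ?d (- \<alpha>) n y" if "y < 0" for n y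
  proof -
    have "c2_deriv lam \<alpha> n y = (- \<alpha> / 2) ^ n * (- 1) ^ n *
        (\<Sum>i\<le>n. real (n choose i) * bessel_K (lam - 1/2 - (2 * real i - real n)) (- \<alpha> * y))"
      using that by (simp add: c2_deriv_def sum_distrib_left mult_ac)
    also have "(- \<alpha> / 2) ^ n * (- 1) ^ n = (- (- \<alpha>) / 2) ^ n"
      by (simp add: power_mult_distrib[symmetric])
    finally show ?thesis .
  qed
  show "(c2_deriv lam \<alpha> n has_real_derivative c2_deriv lam \<alpha> (Suc n) y) (at y)"
  proof (cases "y > 0")
    case True
    have "(?d \<alpha> n has_real_derivative ?d \<alpha> (Suc n) y) (at y)"
      using True assms by (intro has_real_derivative_bessel_K_sum) auto
    then have "(?d \<alpha> n has_real_derivative c2_deriv lam \<alpha> (Suc n) y) (at y)"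
      using pos[OF True] by simp
    then show ?thesis
      by (rule has_field_derivative_transform_within_open[where S = "{0<..}"])
        (use True pos in auto)
  next
    case False
    with y have "y < 0" by simp
    have "(?d (- \<alpha>) n has_real_derivative ?d (- \<alpha>) (Suc n) y) (at y)"
      using \<open>y < 0\<close> assms by (intro has_real_derivative_bessel_K_sum) (auto simp: mult_pos_neg)
    then have "(?d (- \<alpha>) n has_real_derivative c2_deriv lam \<alpha> (Suc n) y) (at y)"
      unfolding neg[OF \<open>y < 0\<close>] .
    then show ?thesis
      by (rule has_field_derivative_transform_within_open[where S = "{..<0}"])
        (use \<open>y < 0\<close> neg in auto)
  qed
qed

lemma faa_di_bruno_0 [simp]: "faa_di_bruno 0 F H = F 0"
  by (simp add: faa_di_bruno_conv_fps)

lemma derivs_on_c_deriv: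
  assumes "\<alpha> > 0"
  shows "derivs_on UNIV (- {0}) (c_deriv lam \<alpha>)"
  unfolding derivs_on_def c_deriv_def[abs_def]
proof (intro allI ballI has_real_derivative_faa_di_bruno)
  fix y :: real assume y: "y \<in> - {0}"
  show H: "(c2_deriv lam \<alpha> j has_real_derivative c2_deriv lam \<alpha> (Suc j) y) (at y)" for j
    using derivs_onD[OF derivs_on_c2_deriv[OF assms] y] .
  have c2_0: "c2_deriv lam \<alpha> 0 y = bessel_K (lam - 1/2) (\<alpha> * \<bar>y\<bar>)" for y
    by (cases "y > 0") (auto simp: c2_deriv_def)
  have nz: "bessel_K (lam - 1/2) (\<alpha> * \<bar>y\<bar>) \<noteq> 0"
    using bessel_K_pos[of "\<alpha> * \<bar>y\<bar>" "lam - 1/2"] assms y by simp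
  show "((\<lambda>y. c1_deriv k (bessel_K (lam - 1/2) (\<alpha> * \<bar>y\<bar>))) has_real_derivative
      c1_deriv (Suc k) (bessel_K (lam - 1/2) (\<alpha> * \<bar>y\<bar>)) * c2_deriv lam \<alpha> 1 y) (at y)" for k
  proof -
    have "((\<lambda>y. c1_deriv k (c2_deriv lam \<alpha> 0 y)) has_real_derivative
        c1_deriv (Suc k) (c2_deriv lam \<alpha> 0 y) * c2_deriv lam \<alpha> (Suc 0) y) (at y)"
      using nz by (intro DERIV_chain2[where f = "c1_deriv k"] H has_real_derivative_c1_deriv) (simp add: c2_0)
    then show ?thesis by (simp only: c2_0 One_nat_def)
  qed
qed

context vg_parameters
begin

abbreviation g' :: "nat \<Rightarrow> real \<Rightarrow> real" where "g' \<equiv> g_deriv lam \<alpha> \<beta>"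

lemma g_deriv_0:
  assumes "y \<noteq> 0"
  shows "g' 0 y = g y"
proof -
  have "\<bar>y\<bar> powr (1/2 - lam) = 1 / \<bar>y\<bar> powr (lam - 1/2)"
    using powr_minus_divide[of "\<bar>y\<bar>" "lam - 1/2"] by simp
  moreover have "g' 0 y = N\<^sub>0 * (exp (- \<beta> * y) * \<bar>y\<bar> powr (1/2 - lam) *
      (1 / bessel_K (lam - 1/2) (\<alpha> * \<bar>y\<bar>)))"
    by (simp add: g_deriv_def N\<^sub>0_def a_deriv_def b_deriv_def c_deriv_def c1_deriv_def)
  moreover have "exp (- \<beta> * y) = 1 / exp (\<beta> * y)"
    by (simp add: exp_minus divide_inverse)
  ultimately have "g' 0 y = N\<^sub>0 * (1 / exp (\<beta> * y) * (1 / \<bar>y\<bar> powr (lam - 1/2)) *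
      (1 / bessel_K (lam - 1/2) (\<alpha> * \<bar>y\<bar>)))"
    by (simp only:)
  also have "\<dots> = 1 / f y"
    unfolding f_eq by simp
  finally show ?thesis
    using assms by (simp add: vg_g_def)
qed

text \<open>Leibniz' rule twice, for the product of \<open>a\<close> with the product of
  \<open>c\<close> and \<open>b\<close>.\<close>

lemma derivs_on_g_deriv: "derivs_on UNIV (- {0}) g'"
proof -
  have "derivs_on UNIV (- {0}) (\<lambda>n y. N\<^sub>0 * (\<Sum>k\<le>n. real (n choose k) * (a_deriv \<beta> (n - k) y *
      (\<Sum>j\<le>k. real (k choose j) * (c_deriv lam \<alpha> (k - j) y * b_deriv lam j y)))))"
    by (intro derivs_on_cmult derivs_on_mult derivs_on_a_deriv derivs_on_b_deriv derivs_on_c_deriv alpha_pos)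
  also have "(\<lambda>n y. N\<^sub>0 * (\<Sum>k\<le>n. real (n choose k) * (a_deriv \<beta> (n - k) y *
      (\<Sum>j\<le>k. real (k choose j) * (c_deriv lam \<alpha> (k - j) y * b_deriv lam j y))))) = g'"
    by (simp add: g_deriv_def[abs_def] N\<^sub>0_def sum_distrib_left mult_ac)
  finally show ?thesis .
qed

lemma deriv_funpow_g:
  assumes "y \<noteq> 0"
  shows "(deriv ^^ n) g y = g' n y"
  using assms
proof (induction n arbitrary: y)
  case (Suc n)
  have "((deriv ^^ n) g has_real_derivative g' (Suc n) y) (at y)"
    by (rule has_field_derivative_transform_within_open[OF derivs_onD[OF derivs_on_g_deriv], of _ "- {0}"])
      (use Suc in auto)
  then show ?case by (simp add: DERIV_imp_deriv)
qed (simp add: g_deriv_0)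

lemma deriv_funpow_g_differentiable:
  assumes "y \<noteq> 0"
  shows "(deriv ^^ n) g field_differentiable at y"
proof -
  have "((deriv ^^ n) g has_real_derivative g' (Suc n) y) (at y)"
    by (rule has_field_derivative_transform_within_open[OF derivs_onD[OF derivs_on_g_deriv], of _ "- {0}"])
      (use assms deriv_funpow_g in auto)
  then show ?thesis by (auto simp: field_differentiable_def)
qed

end

context vg_parameters
begin

subsection \<open>The quantile transform\<close>

abbreviation B :: "real \<Rightarrow> real" where "B \<equiv> base_quantile lam \<alpha> \<beta>"

text \<open>The base distribution function in closed form. It inverts \<open>B\<close>, so the
  quantile transform is \<open>Q\<close> after \<open>U\<close>.\<close>

definition U :: "real \<Rightarrow> real" where
  "U z = (if z \<le> 0 then p * exp ((\<alpha> + \<beta>) * z) else 1 - (1 - p) * exp (- ((\<alpha> - \<beta>) * z)))"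

lemma rate_pos: "\<alpha> + \<beta> > 0" "\<alpha> - \<beta> > 0"
  using beta_less by auto

lemma B_p [simp]: "B p = 0"
  using p_bounds by (simp add: base_quantile_def)

lemma U_le_p: "z \<le> 0 \<Longrightarrow> U z \<in> {0<..p}"
  using p_bounds rate_pos by (auto simp: U_def mult_le_cancel_left1 mult_nonneg_nonpos)

lemma U_gt_p: "z > 0 \<Longrightarrow> U z \<in> {p<..<1}"
proof -
  assume "z > 0"
  then have "exp (- ((\<alpha> - \<beta>) * z)) < 1"
    using rate_pos by (simp add: mult_pos_pos)
  define w where "w = (1 - p) * exp (- ((\<alpha> - \<beta>) * z))"
  have "w < (1 - p) * 1" "w > 0"
    unfolding w_def using p_bounds \<open>exp (- ((\<alpha> - \<beta>) * z)) < 1\<close>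
    by (intro mult_strict_left_mono mult_pos_pos; simp)+
  moreover have "U z = 1 - w"
    using \<open>z > 0\<close> by (simp add: U_def w_def)
  ultimately show ?thesis by simp
qed

lemma U_in: "U z \<in> {0<..<1}"
  using U_le_p[of z] U_gt_p[of z] p_bounds by (cases "z \<le> 0") auto

lemma B_U [simp]: "B (U z) = z"
proof (cases "z \<le> 0")
  case True
  then have "U z / p = exp ((\<alpha> + \<beta>) * z)"
    using p_bounds by (simp add: U_def)
  then show ?thesis
    using True U_le_p[OF True] rate_pos by (simp add: base_quantile_def)
next
  case False
  then have "(1 - U z) / (1 - p) = exp (- ((\<alpha> - \<beta>) * z))"
    using p_bounds by (simp add: U_def)
  then show ?thesis
    using False U_gt_p[of z] rate_pos by (simp add: base_quantile_def p_plus_def)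
qed

lemma U_B:
  assumes "u \<in> {0<..<1}"
  shows "U (B u) = u"
proof (cases "u \<le> p")
  case True
  then have "B u = ln (u / p) / (\<alpha> + \<beta>)" "ln (u / p) \<le> 0"
    using assms p_bounds by (auto simp: base_quantile_def ln_le_zero_iff divide_pos_pos)
  then have "B u \<le> 0" "(\<alpha> + \<beta>) * B u = ln (u / p)"
    using rate_pos by (auto simp: divide_le_0_iff)
  then show ?thesis
    using assms p_bounds by (simp add: U_def)
next
  case False
  then have "B u = - (ln ((1 - u) / (1 - p)) / (\<alpha> - \<beta>))" "ln ((1 - u) / (1 - p)) < 0"
    using assms p_bounds by (auto simp: base_quantile_def p_plus_def ln_less_zero_iff divide_pos_pos)
  then have "B u > 0" "- ((\<alpha> - \<beta>) * B u) = ln ((1 - u) / (1 - p))"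
    using rate_pos by (auto simp: divide_less_0_iff)
  then show ?thesis
    using assms p_bounds by (simp add: U_def)
qed

lemma isCont_U: "isCont U z"
proof -
  \<comment> \<open>Both branches take the value \<open>p\<close> at \<open>0\<close>.\<close>
  have "continuous_on ({..0} \<union> {0..}) U"
    unfolding U_def[abs_def] by (rule continuous_on_If) (auto intro!: continuous_intros)
  moreover have "{..0} \<union> {0..} = (UNIV :: real set)" by auto
  ultimately show ?thesis
    by (simp add: continuous_on_eq_continuous_at)
qed

lemma has_real_derivative_U:
  "z < 0 \<Longrightarrow> (U has_real_derivative p * (\<alpha> + \<beta>) * exp ((\<alpha> + \<beta>) * z)) (at z)"
  "z > 0 \<Longrightarrow> (U has_real_derivative p_plus lam \<alpha> \<beta> * (\<alpha> - \<beta>) * exp (- (\<alpha> - \<beta>) * z)) (at z)"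
proof -
  assume "z < 0"
  have "((\<lambda>z. p * exp ((\<alpha> + \<beta>) * z)) has_real_derivative p * (\<alpha> + \<beta>) * exp ((\<alpha> + \<beta>) * z)) (at z)"
    by (auto intro!: derivative_eq_intros)
  then show "(U has_real_derivative p * (\<alpha> + \<beta>) * exp ((\<alpha> + \<beta>) * z)) (at z)"
    by (rule has_field_derivative_transform_within_open[where S = "{..<0}"])
      (use \<open>z < 0\<close> in \<open>auto simp: U_def\<close>)
next
  assume "z > 0"
  have "((\<lambda>z. 1 - (1 - p) * exp (- ((\<alpha> - \<beta>) * z))) has_real_derivative
      0 - (1 - p) * (exp (- ((\<alpha> - \<beta>) * z)) * - ((\<alpha> - \<beta>) * 1))) (at z)"
    by (intro DERIV_diff DERIV_const DERIV_cmult DERIV_fun_exp DERIV_minus DERIV_ident)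
  also have "0 - (1 - p) * (exp (- ((\<alpha> - \<beta>) * z)) * - ((\<alpha> - \<beta>) * 1)) =
      p_plus lam \<alpha> \<beta> * (\<alpha> - \<beta>) * exp (- (\<alpha> - \<beta>) * z)"
    unfolding p_plus_def minus_mult_left[symmetric]
    by (simp only: mult_ac mult_1_right mult_1_left mult_minus_right mult_minus_left diff_0 minus_minus)
  finally show "(U has_real_derivative p_plus lam \<alpha> \<beta> * (\<alpha> - \<beta>) * exp (- (\<alpha> - \<beta>) * z)) (at z)"
    by (rule has_field_derivative_transform_within_open[where S = "{0<..}"])
      (use \<open>z > 0\<close> in \<open>auto simp: U_def\<close>)
qed

lemma QU_nonzero: "z \<noteq> 0 \<Longrightarrow> Q (U z) \<noteq> 0"
proof
  assume "z \<noteq> 0" "Q (U z) = 0"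
  then have "U z = p"
    using F_Q[OF U_in, of z] by (simp add: p_minus_def)
  then show False
    using B_U[of z] \<open>z \<noteq> 0\<close> by simp
qed

lemma has_real_derivative_QU:
  assumes "z \<noteq> 0" "(U has_real_derivative d) (at z)"
  shows "((\<lambda>z. Q (U z)) has_real_derivative d * g (Q (U z))) (at z)"
proof -
  have "((\<lambda>z. Q (U z)) has_real_derivative inverse (f (Q (U z))) * d) (at z)"
    by (rule DERIV_chain2[where f = Q]) (use assms QU_nonzero U_in in \<open>auto intro: has_real_derivative_Q\<close>)
  then show ?thesis
    using QU_nonzero[OF assms(1)] by (simp add: vg_g_def divide_inverse mult.commute)
qed

lemma has_real_derivative_QU_left:
  assumes "z < 0"
  shows "((\<lambda>z. Q (U z)) has_real_derivative g_L lam \<alpha> \<beta> (\<lambda>z. Q (U z)) z) (at z)"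
  unfolding g_L_def using assms by (intro has_real_derivative_QU has_real_derivative_U(1)) auto

lemma has_real_derivative_QU_right:
  assumes "z > 0"
  shows "((\<lambda>z. Q (U z)) has_real_derivative g_R lam \<alpha> \<beta> (\<lambda>z. Q (U z)) z) (at z)"
  unfolding g_R_def using assms by (intro has_real_derivative_QU has_real_derivative_U(2)) auto

lemma isCont_QU: "isCont (\<lambda>z. Q (U z)) z"
  by (rule isCont_o2[OF isCont_U isCont_Q[OF U_in]])

lemma isCont_gA: "continuous (at z within S) A \<Longrightarrow> continuous (at z within S) (\<lambda>z. g (A z))"
  using continuous_within_compose2[of z S A g] isCont_g[of "A z"] continuous_at_imp_continuous_at_within
  by blast

text \<open>At \<open>z = 0\<close> the density may be infinite, and the inverse function theorem is replaced by
  the limit of the derivatives.\<close>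
lemma has_real_derivative_QU_0:
  "((\<lambda>z. Q (U z)) has_real_derivative g_L lam \<alpha> \<beta> (\<lambda>z. Q (U z)) 0) (at 0 within {..0})"
proof -
  let ?A = "\<lambda>z. Q (U z)"
  let ?G = "g_L lam \<alpha> \<beta> ?A"
  have cont: "continuous (at_left 0) ?A"
    using isCont_QU continuous_at_imp_continuous_at_within by blast
  have "continuous (at_left 0) ?G"
    unfolding g_L_def[abs_def] by (intro continuous_intros isCont_gA cont)
  then have G: "(?G \<longlongrightarrow> ?G 0) (at_left 0)"
    by (simp add: continuous_within)
  have neg: "\<forall>\<^sub>F z in at_left 0. z < (0 :: real)"
    by (auto simp: eventually_at_filter)
  have "((\<lambda>z. (?A z - ?A 0) / (z - 0)) \<longlongrightarrow> ?G 0) (at_left 0)"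
  \<comment> \<open>With the denominator \<open>z - 0\<close>, L'Hopital's rule passes from the
    limit of the derivative to the one-sided derivative; the limit exists because \<open>g\<close>
    is continuous at \<open>0\<close>.\<close>
  proof (rule lhopital_left[where f' = ?G and g' = "\<lambda>_. 1"])
    show "((\<lambda>z. ?A z - ?A 0) \<longlongrightarrow> 0) (at_left 0)"
      using cont by (simp add: continuous_within LIM_zero)
    show "((\<lambda>z. z - 0) \<longlongrightarrow> (0 :: real)) (at_left 0)"
      by (auto intro!: tendsto_eq_intros)
    show "\<forall>\<^sub>F z in at_left 0. ((\<lambda>z. ?A z - ?A 0) has_real_derivative ?G z) (at z)"
      using neg
    proof eventually_elim
      case (elim z)
      show ?case
        using has_real_derivative_QU_left[OF elim] by (auto intro!: derivative_eq_intros)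
    qed
    show "((\<lambda>z. ?G z / 1) \<longlongrightarrow> ?G 0) (at_left 0)"
      using G by simp
  qed (use neg in \<open>auto elim: eventually_mono intro!: derivative_eq_intros\<close>)
  then show ?thesis
    by (simp only: has_field_derivative_iff at_within_Iic_at_left)
qed

lemma solves_left_QU:
  assumes "u\<^sub>0 \<in> {0<..p}"
  shows "solves_left lam \<alpha> \<beta> u\<^sub>0 UNIV (\<lambda>z. Q (U z))"
  unfolding solves_left_def left_dom_def
proof (intro conjI ballI)
  show "Q (U (B u\<^sub>0)) = Q u\<^sub>0"
    using assms p_bounds by (subst U_B) auto
  fix z assume "z \<in> {..B p} \<inter> UNIV"
  then show "((\<lambda>z. Q (U z)) has_real_derivative g_L lam \<alpha> \<beta> (\<lambda>z. Q (U z)) z) (at z within {..B p})"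
    using has_real_derivative_QU_left[of z] has_real_derivative_QU_0
    by (cases "z = 0") (auto intro: has_field_derivative_at_within)
qed

lemma solves_right_QU:
  assumes "u\<^sub>0 \<in> {p..<1}"
  shows "solves_right lam \<alpha> \<beta> u\<^sub>0 UNIV (\<lambda>z. Q (U z))"
  unfolding solves_right_def
proof (intro conjI ballI)
  show "Q (U (B u\<^sub>0)) = Q u\<^sub>0"
    using assms p_bounds by (subst U_B) auto
qed (use has_real_derivative_QU_right in auto)

text \<open>\<open>B\<close> maps the unit interval onto the whole line, so the relation fixes
  \<open>A\<close> at every real point; existence, uniqueness and the closed form come
  together.\<close>

lemma quantile_transform_iff:
  "(\<forall>u\<in>{0<..<1}. Q u = A (B u)) \<longleftrightarrow> A = (\<lambda>z. Q (U z))"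
proof
  assume *: "\<forall>u\<in>{0<..<1}. Q u = A (B u)"
  show "A = (\<lambda>z. Q (U z))"
    using *[rule_format, OF U_in] by (simp add: fun_eq_iff)
qed (simp add: U_B)

end

subsection \<open>Series solutions\<close>

lemma diffs_funpow: "(diffs ^^ k) a n = fact (n + k) / fact n * a (n + k)"
  for a :: "nat \<Rightarrow> real"
proof (induction k arbitrary: n)
  case (Suc k)
  have "(diffs ^^ Suc k) a n = real (Suc n) * ((diffs ^^ k) a (Suc n))"
    by (simp add: diffs_def)
  also have "\<dots> = real (Suc n) * (fact (n + Suc k) / fact (Suc n) * a (n + Suc k))"
    by (simp only: Suc.IH add_Suc_shift)
  also have "\<dots> = fact (n + Suc k) / fact n * a (n + Suc k)"
    by (simp add: field_simps del: of_nat_Suc add_Suc_right)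
  finally show ?case .
qed simp

text \<open>Convergence on one side of the centre, the side being given by the sign \<open>s\<close>, suffices.\<close>
lemma power_series_derivs:
  fixes A :: "real \<Rightarrow> real"
  assumes series: "has_series_on A a z\<^sub>0 D" and D: "D \<subseteq> ball z\<^sub>0 r"
    and half: "\<bar>s\<bar> = 1" "\<And>t. 0 < t \<Longrightarrow> t < r \<Longrightarrow> z\<^sub>0 + s * t \<in> D"
  obtains P where "derivs_on S D P" "\<And>z. z \<in> D \<Longrightarrow> P 0 z = A z" "\<And>k. P k z\<^sub>0 = fact k * a k"
proof -
  have summ: "summable (\<lambda>n. (diffs ^^ k) a n * w ^ n)" if "\<bar>w\<bar> < r" for k w
    using that
  proof (induction k arbitrary: w)
    case 0
    \<comment> \<open>The series converges at the point of \<open>D\<close> at distance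
      \<open>t\<close> on the given side, hence at all points strictly closer to the centre, on
      either side.\<close>
    obtain t where t: "\<bar>w\<bar> < t" "t < r" using 0 dense by blast
    then have "(\<lambda>n. a n * (s * t) ^ n) sums A (z\<^sub>0 + s * t)"
      using series half(2)[of t] by (force simp: has_series_on_def)
    then have "summable (\<lambda>n. a n * w ^ n)"
      using t half(1) by (intro powser_inside[OF sums_summable]) (auto simp: abs_mult)
    then show ?case by simp
  next
    case (Suc k)
    then show ?case
      using termdiff_converges[of w r "(diffs ^^ k) a"] by simp
  qed
  define P where "P = (\<lambda>k z. \<Sum>n. (diffs ^^ k) a n * (z - z\<^sub>0) ^ n)"
  have "derivs_on S D P"
    unfolding derivs_on_def
  proof (intro allI ballI)
    fix k z assume "z \<in> D"
    then have "\<bar>z - z\<^sub>0\<bar> < r"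
      using D by (auto simp: dist_real_def abs_minus_commute)
    then have "((\<lambda>w. \<Sum>n. (diffs ^^ k) a n * w ^ n) has_real_derivative P (Suc k) z) (at (z - z\<^sub>0))"
      using termdiffs_strong'[of r "(diffs ^^ k) a" "z - z\<^sub>0"] summ by (simp add: P_def)
    then have "(P k has_real_derivative P (Suc k) z * 1) (at z within S)"
      unfolding P_def[THEN fun_cong, of k]
      by (rule DERIV_chain2) (auto intro!: derivative_eq_intros)
    then show "(P k has_real_derivative P (Suc k) z) (at z within S)" by simp
  qed
  moreover have "P 0 z = A z" if "z \<in> D" for z
    using series that by (auto simp: P_def has_series_on_def sums_iff)
  moreover have "P k z\<^sub>0 = fact k * a k" for k
    using powser_zero[of "(diffs ^^ k) a"] by (simp add: P_def diffs_funpow)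
  ultimately show ?thesis using that by blast
qed

context vg_parameters
begin

text \<open>The left problem is the case \<open>c = p\<^sub>-\<close>, \<open>k = \<alpha> + \<beta>\<close>, the right problem the case
  \<open>c = - p\<^sub>+\<close>, \<open>k = - (\<alpha> - \<beta>)\<close>.\<close>
lemma series_solution:
  fixes A G :: "real \<Rightarrow> real" and c k :: real and S D :: "real set"
  assumes D: "openin (top_of_set S) D" and nontriv: "\<And>z. z \<in> D \<Longrightarrow> at z within S \<noteq> bot"
    and z0: "z\<^sub>0 \<in> D"
    and P: "derivs_on S D P" "\<And>z. z \<in> D \<Longrightarrow> P 0 z = A z" "\<And>n. P n z\<^sub>0 = fact n * a n"
    and G: "\<And>z. G z = c * k * exp (k * z) * g (A z)" and ck: "c * k \<noteq> 0"
    and ode: "\<And>z. z \<in> D \<Longrightarrow> (A has_real_derivative G z) (at z within S)"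
  shows "\<forall>n\<ge>1. a n = nth_deriv_within S (n - 1) G z\<^sub>0 / fact n"
    and "smooth_within S D G"
    and "smooth_within S D (g \<circ> A)"
    and "\<forall>n. \<forall>z\<in>D. nth_deriv_within S n G z = c * exp (k * z) *
      (\<Sum>i\<le>n. real (n choose i) * k ^ (i + 1) * nth_deriv_within S (n - i) (g \<circ> A) z)"
    and "gA_formula lam \<alpha> \<beta> S D A G"
proof -
  note cong = has_real_derivative_cong_openin[OF _ D]
  have A: "(A has_real_derivative P 1 z) (at z within S)" if "z \<in> D" for z
    using cong[OF derivs_onD[OF P(1) that, of 0] that, of A] P(2) by simp
  have G_eq: "G z = P 1 z" if "z \<in> D" for z
    using vector_derivative_within[OF nontriv[OF that], of A] ode[OF that] A[OF that]
    unfolding has_real_derivative_iff_has_vector_derivative by metis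
  have derivs_G: "derivs_on S D (\<lambda>n. P (Suc n))"
    using P(1) by (simp add: derivs_on_def)
  have nth_G: "nth_deriv_within S n G z = P (Suc n) z" if "z \<in> D" for n z
    using nth_deriv_within_eq[OF derivs_G D nontriv _ that, of G] G_eq by simp
  show "\<forall>n\<ge>1. a n = nth_deriv_within S (n - 1) G z\<^sub>0 / fact n"
  proof (intro allI impI)
    fix n :: nat assume "n \<ge> 1"
    then have "nth_deriv_within S (n - 1) G z\<^sub>0 = fact n * a n"
      using nth_G[OF z0, of "n - 1"] P(3)[of n] by simp
    then show "a n = nth_deriv_within S (n - 1) G z\<^sub>0 / fact n" by simp
  qed
  show smooth_G: "smooth_within S D G"
    using smooth_withinI[OF derivs_G D nontriv] G_eq by simp
  \<comment> \<open>Leibniz' rule for \<open>P 1 z * exp (- k * z) / (c * k)\<close>. The tower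
    serves only to make \<open>g \<circ> A\<close> smooth; the formula for the derivatives of
    \<open>G\<close> then comes from Leibniz' rule in the opposite direction.\<close>
  let ?q = "\<lambda>n z. 1 / (c * k) * (\<Sum>i\<le>n. real (n choose i) * (P (Suc (n - i)) z * ((- k) ^ i * exp (- k * z))))"
  have derivs_gA: "derivs_on S D ?q"
    by (intro derivs_on_cmult derivs_on_mult derivs_G derivs_on_exp)
  have gA_eq: "(g \<circ> A) z = ?q 0 z" if "z \<in> D" for z
    using ck G[of z] G_eq[OF that] by (simp add: exp_minus field_simps)
  note nth_gA = nth_deriv_within_eq[OF derivs_gA D nontriv gA_eq]
  show smooth_gA: "smooth_within S D (g \<circ> A)"
    using smooth_withinI[OF derivs_gA D nontriv gA_eq] .
  have derivs_gA': "derivs_on S D (\<lambda>n. nth_deriv_within S n (g \<circ> A))"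
    using smooth_gA by (simp add: smooth_within_def derivs_on_def)
  have derivs_G': "derivs_on S D (\<lambda>n z. c * k * (\<Sum>i\<le>n. real (n choose i) *
      (nth_deriv_within S (n - i) (g \<circ> A) z * (k ^ i * exp (k * z)))))"
    by (intro derivs_on_cmult derivs_on_mult derivs_gA' derivs_on_exp)
  have "nth_deriv_within S n G z = c * k * (\<Sum>i\<le>n. real (n choose i) *
      (nth_deriv_within S (n - i) (g \<circ> A) z * (k ^ i * exp (k * z))))" if "z \<in> D" for n z
  proof (rule nth_deriv_within_eq[OF derivs_G' D nontriv _ that])
    show "G w = c * k * (\<Sum>i\<le>0. real (0 choose i) *
        (nth_deriv_within S (0 - i) (g \<circ> A) w * (k ^ i * exp (k * w))))" for w
      unfolding G by simp
  qed
  note nth_G_sum = this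
  have alg: "c * k * (\<Sum>i\<le>n. real (n choose i) * (X (n - i) * (k ^ i * e))) =
      c * e * (\<Sum>i\<le>n. real (n choose i) * k ^ (i + 1) * X (n - i))" for n e and X :: "nat \<Rightarrow> real"
    unfolding sum_distrib_left by (intro sum.cong refl) simp
  show "\<forall>n. \<forall>z\<in>D. nth_deriv_within S n G z = c * exp (k * z) *
      (\<Sum>i\<le>n. real (n choose i) * k ^ (i + 1) * nth_deriv_within S (n - i) (g \<circ> A) z)"
    using trans[OF nth_G_sum alg[where X = "\<lambda>i. nth_deriv_within S i (g \<circ> A) _"]] by blast
  \<comment> \<open>Here the chain rule through \<open>g\<close> is legitimate; as \<open>A\<close>
    is continuous, the set is relatively open, so towers on it determine the iterated
    derivatives.\<close>
  define D' where "D' = {z\<in>D. A z \<noteq> 0}"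
  have contA: "continuous_on D A"
    unfolding continuous_on_def
  proof
    fix z assume z: "z \<in> D"
    have "(A \<longlongrightarrow> A z) (at z within S)"
      using DERIV_continuous[OF A[OF z]] by (simp add: continuous_within)
    then show "(A \<longlongrightarrow> A z) (at z within D)"
      using openin_imp_subset[OF D] tendsto_within_subset by blast
  qed
  have "openin (top_of_set D) (D \<inter> A -` (- {0}))"
    by (intro continuous_openin_preimage_gen contA) auto
  moreover have "D \<inter> A -` (- {0}) = D'"
    by (auto simp: D'_def)
  ultimately have D': "openin (top_of_set S) D'"
    using openin_trans[OF _ D] by simp
  have subset: "D' \<subseteq> D" by (auto simp: D'_def)
  have derivs_fdb: "derivs_on S D' (\<lambda>m w. gA_deriv lam \<alpha> \<beta> S A G m w)"
    unfolding derivs_on_def gA_deriv_def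
  proof (intro allI ballI has_real_derivative_faa_di_bruno)
    fix m z assume z: "z \<in> D'"
    then have "z \<in> D" "A z \<noteq> 0" by (auto simp: D'_def)
    show "((\<lambda>z. g' i (A z)) has_real_derivative g' (Suc i) (A z) * nth_deriv_within S (1 - 1) G z) (at z within S)" for i
    proof -
      have "((\<lambda>z. g' i (A z)) has_real_derivative g' (Suc i) (A z) * G z) (at z within S)"
        by (rule DERIV_chain2[OF derivs_onD[OF derivs_on_g_deriv] ode])
          (use \<open>z \<in> D\<close> \<open>A z \<noteq> 0\<close> in auto)
      then show ?thesis by simp
    qed
    \<comment> \<open>The restriction \<open>j \<ge> 1\<close> keeps the truncated subtraction
      honest: \<open>Suc j - 1\<close> is the successor of \<open>j - 1\<close>.\<close>
    show "((\<lambda>z. nth_deriv_within S (j - 1) G z) has_real_derivative nth_deriv_within S (Suc j - 1) G z) (at z within S)"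
      if "j \<ge> 1" for j
      using smooth_G \<open>z \<in> D\<close> that unfolding smooth_within_def by (cases j) auto
  qed
  have fdb: "nth_deriv_within S m (g \<circ> A) z = gA_deriv lam \<alpha> \<beta> S A G m z" if "z \<in> D'" for m z
  proof (rule nth_deriv_within_eq[OF derivs_fdb D' _ _ that])
    fix w assume w: "w \<in> D'"
    show "at w within S \<noteq> bot"
      using nontriv w subset by blast
    show "(g \<circ> A) w = gA_deriv lam \<alpha> \<beta> S A G 0 w"
      using w by (simp add: D'_def gA_deriv_def g_deriv_0)
  qed
  show "gA_formula lam \<alpha> \<beta> S D A G"
    unfolding gA_formula_def
  proof (intro allI ballI conjI impI)
    fix m z assume z: "z \<in> D"
    show "nth_deriv_within S m (g \<circ> A) z = gA_deriv lam \<alpha> \<beta> S A G m z" if "A z \<noteq> 0"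
      using fdb z that by (simp add: D'_def)
    \<comment> \<open>The derivatives of \<open>g \<circ> A\<close> are continuous within
      \<open>S\<close>, also at zeros of \<open>A\<close>, and agree near \<open>z\<close> with the
      formula wherever \<open>A\<close> does not vanish; so the formula has the derivative as its
      limit.\<close>
    let ?W = "{w\<in>S. A w \<noteq> 0}"
    have "(nth_deriv_within S m (g \<circ> A) \<longlongrightarrow> nth_deriv_within S m (g \<circ> A) z) (at z within S)"
      using DERIV_continuous[OF derivs_onD[OF derivs_gA' z, of m]] by (simp add: continuous_within)
    then have lim: "(nth_deriv_within S m (g \<circ> A) \<longlongrightarrow> nth_deriv_within S m (g \<circ> A) z) (at z within ?W)"
      by (rule tendsto_within_subset) auto
    have "\<forall>x\<in>D. \<exists>e>0. ball x e \<inter> S \<subseteq> D"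
      using D by (auto simp: openin_contains_ball)
    then obtain e where e: "e > 0" "ball z e \<inter> S \<subseteq> D"
      using z by blast
    have ev: "\<forall>\<^sub>F w in at z within ?W. nth_deriv_within S m (g \<circ> A) w = gA_deriv lam \<alpha> \<beta> S A G m w"
      unfolding eventually_at
    proof (intro exI[of _ e] conjI ballI impI)
      fix w assume w: "w \<in> ?W" "w \<noteq> z \<and> dist w z < e"
      then have "w \<in> D'"
        using e(2) by (auto simp: D'_def dist_commute)
      then show "nth_deriv_within S m (g \<circ> A) w = gA_deriv lam \<alpha> \<beta> S A G m w"
        by (rule fdb)
    qed (rule e(1))
    show "((\<lambda>w. gA_deriv lam \<alpha> \<beta> S A G m w) \<longlongrightarrow> nth_deriv_within S m (g \<circ> A) z) (at z within ?W)"
      by (rule Lim_transform_eventually[OF lim ev])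
  qed
qed

lemma B_nonpos: "u \<in> {0<..p} \<Longrightarrow> B u \<le> 0"
  using U_B[of u] U_gt_p[of "B u"] p_bounds by force

lemma B_nonneg: "u \<in> {p..<1} \<Longrightarrow> B u \<ge> 0"
  using U_B[of u] U_le_p[of "B u"] B_p p_bounds by (cases "u = p") force+

text \<open>The left domain contains a left neighbourhood of each of its points. This gives the sign
  \<open>- 1\<close> for the side of convergence and makes derivatives within \<open>S\<close>
  unique.\<close>

lemma left_series:
  assumes u0: "u\<^sub>0 \<in> {0<..p}" and r: "r > 0"
    and S: "S = left_dom lam \<alpha> \<beta>" and D: "D = S \<inter> ball (B u\<^sub>0) r"
    and sol: "solves_left lam \<alpha> \<beta> u\<^sub>0 (ball (B u\<^sub>0) r) A"
    and series: "has_series_on A a (B u\<^sub>0) D"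
  shows "a 0 = Q u\<^sub>0 \<and>
    (\<forall>n\<ge>1. a n = nth_deriv_within S (n - 1) (g_L lam \<alpha> \<beta> A) (B u\<^sub>0) / fact n) \<and>
    smooth_within S D (g_L lam \<alpha> \<beta> A) \<and> smooth_within S D (g \<circ> A) \<and>
    (\<forall>n. \<forall>z\<in>D. nth_deriv_within S n (g_L lam \<alpha> \<beta> A) z = p * exp ((\<alpha> + \<beta>) * z) *
       (\<Sum>k\<le>n. real (n choose k) * (\<alpha> + \<beta>) ^ (k + 1) * nth_deriv_within S (n - k) (g \<circ> A) z)) \<and>
    gA_formula lam \<alpha> \<beta> S D A (g_L lam \<alpha> \<beta> A)"
proof -
  have S': "S = {..0}" by (simp add: S left_dom_def)
  have z0: "B u\<^sub>0 \<in> D"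
    using B_nonpos[OF u0] r by (simp add: D S')
  have nontriv: "at z within S \<noteq> bot" if "z \<in> D" for z
  proof -
    have "at_left z \<le> at z within S"
      using that by (intro at_le) (auto simp: D S')
    then show ?thesis
      using trivial_limit_at_left_real[of z] by (auto simp: bot_unique)
  qed
  obtain P where P: "derivs_on S D P" "\<And>z. z \<in> D \<Longrightarrow> P 0 z = A z" "\<And>n. P n (B u\<^sub>0) = fact n * a n"
    by (rule power_series_derivs[OF series, of r "-1" S])
      (use B_nonpos[OF u0] in \<open>auto simp: D S' dist_real_def\<close>)
  have ode: "(A has_real_derivative g_L lam \<alpha> \<beta> A z) (at z within S)" if "z \<in> D" for z
    using sol that unfolding solves_left_def D S left_dom_def by simp
  have ck: "p * (\<alpha> + \<beta>) \<noteq> 0"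
    using p_bounds rate_pos by simp
  have openin: "openin (top_of_set S) D"
    unfolding D by (rule openin_open_Int) simp
  show ?thesis
  proof (intro conjI)
    show "a 0 = Q u\<^sub>0"
      using P(2)[OF z0] P(3)[of 0] sol by (simp add: solves_left_def)
  qed (rule series_solution[OF openin nontriv z0 P g_L_def ck ode]; assumption)+
qed

text \<open>For \<open>u\<^sub>0 = p\<close> the equation is not imposed at the initial point. It
  extends there because the derivative of the series and the right-hand side are both continuous
  within \<open>S\<close> and agree at the other points nearby.\<close>

lemma right_series:
  assumes u0: "u\<^sub>0 \<in> {p..<1}" and r: "r > 0"
    and S: "S = right_dom lam \<alpha> \<beta> u\<^sub>0" and D: "D = S \<inter> ball (B u\<^sub>0) r"
    and sol: "solves_right lam \<alpha> \<beta> u\<^sub>0 (ball (B u\<^sub>0) r) A"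
    and series: "has_series_on A a (B u\<^sub>0) D"
  shows "a 0 = Q u\<^sub>0 \<and>
    (\<forall>n\<ge>1. a n = nth_deriv_within S (n - 1) (g_R lam \<alpha> \<beta> A) (B u\<^sub>0) / fact n) \<and>
    smooth_within S D (g_R lam \<alpha> \<beta> A) \<and> smooth_within S D (g \<circ> A) \<and>
    (\<forall>n. \<forall>z\<in>D. nth_deriv_within S n (g_R lam \<alpha> \<beta> A) z = p_plus lam \<alpha> \<beta> * exp (- (\<alpha> - \<beta>) * z) *
       (\<Sum>k\<le>n. real (n choose k) * (- 1) ^ k * (\<alpha> - \<beta>) ^ (k + 1) * nth_deriv_within S (n - k) (g \<circ> A) z)) \<and>
    gA_formula lam \<alpha> \<beta> S D A (g_R lam \<alpha> \<beta> A)"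
proof -
  let ?G = "g_R lam \<alpha> \<beta> A"
  have S': "S = insert (B u\<^sub>0) {0<..}" by (simp add: S right_dom_def)
  have z0: "B u\<^sub>0 \<in> D"
    using r by (simp add: D S')
  have z0_nonneg: "B u\<^sub>0 \<ge> 0"
    by (rule B_nonneg[OF u0])
  have nontriv: "at z within S \<noteq> bot" if "z \<in> D" for z
  proof -
    have "at_right z \<le> at z within S"
      using that z0_nonneg by (intro at_le) (auto simp: D S')
    then show ?thesis
      using trivial_limit_at_right_real[of z] by (auto simp: bot_unique)
  qed
  obtain P where P: "derivs_on S D P" "\<And>z. z \<in> D \<Longrightarrow> P 0 z = A z" "\<And>n. P n (B u\<^sub>0) = fact n * a n"
    by (rule power_series_derivs[OF series, of r 1 S])
      (use z0_nonneg in \<open>auto simp: D S' dist_real_def\<close>)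
  have openin: "openin (top_of_set S) D"
    unfolding D by (rule openin_open_Int) simp
  have A: "(A has_real_derivative P 1 z) (at z within S)" if "z \<in> D" for z
    using has_real_derivative_cong_openin[OF derivs_onD[OF P(1) that, of 0] openin that, of A] P(2)
    by simp
  have ode_pos: "(A has_real_derivative ?G z) (at z within S)" if "z \<in> D" "z > 0" for z
  proof -
    have "(A has_real_derivative ?G z) (at z)"
      using sol that unfolding solves_right_def by (auto simp: D)
    then show ?thesis by (rule has_field_derivative_at_within)
  qed
  have P1_pos: "P 1 z = ?G z" if "z \<in> D" "z > 0" for z
    using vector_derivative_within[OF nontriv[OF that(1)], of A] ode_pos[OF that] A[OF that(1)]
    unfolding has_real_derivative_iff_has_vector_derivative by metis
  have ode: "(A has_real_derivative ?G z) (at z within S)" if z: "z \<in> D" for z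
  proof (cases "z > 0")
    \<comment> \<open>Then \<open>z\<close> is the initial point and equals \<open>0\<close>; all
      other points of \<open>D\<close> are positive.\<close>
    case False
    have "continuous (at z within S) ?G"
      unfolding g_R_def[abs_def]
      by (intro continuous_intros isCont_gA DERIV_continuous[OF A[OF z]])
    then have "(?G \<longlongrightarrow> ?G z) (at z within S)"
      by (simp add: continuous_within)
    moreover have "\<forall>\<^sub>F w in at z within S. ?G w = P 1 w"
    proof -
      have "\<forall>x\<in>D. \<exists>e>0. ball x e \<inter> S \<subseteq> D"
        using openin by (auto simp: openin_contains_ball)
      then obtain e where e: "e > 0" "ball z e \<inter> S \<subseteq> D"
        using z by blast
      have "?G w = P 1 w" if "w \<in> S" "w \<noteq> z" "dist w z < e" for w
      proof -
        have "w \<in> D" using e(2) that by (auto simp: dist_commute)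
        moreover have "w > 0" using that z False by (auto simp: D S')
        ultimately show ?thesis by (rule P1_pos[symmetric])
      qed
      then show ?thesis
        unfolding eventually_at using e(1) by blast
    qed
    ultimately have "(P 1 \<longlongrightarrow> ?G z) (at z within S)"
      by (rule Lim_transform_eventually)
    moreover have "(P 1 \<longlongrightarrow> P 1 z) (at z within S)"
      using DERIV_continuous[OF derivs_onD[OF P(1) z, of 1]] by (simp add: continuous_within)
    ultimately have "?G z = P 1 z"
      using nontriv[OF z] tendsto_unique by blast
    then show ?thesis using A[OF z] by simp
  qed (use ode_pos z in blast)
  let ?c = "- p_plus lam \<alpha> \<beta>" and ?k = "- (\<alpha> - \<beta>)"
  have ck: "?c * ?k \<noteq> 0"
    using p_bounds rate_pos by (simp add: p_plus_def)
  have G: "?G z = ?c * ?k * exp (?k * z) * g (A z)" for z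
    by (simp only: g_R_def mult_minus_left mult_minus_right minus_minus)
  have "nth_deriv_within S n ?G z = p_plus lam \<alpha> \<beta> * exp (- (\<alpha> - \<beta>) * z) *
      (\<Sum>i\<le>n. real (n choose i) * (- 1) ^ i * (\<alpha> - \<beta>) ^ (i + 1) * nth_deriv_within S (n - i) (g \<circ> A) z)"
    if "z \<in> D" for n z
  proof -
    \<comment> \<open>Of the \<open>i + 1\<close> signs one cancels against the sign of
      \<open>?c\<close>, which leaves the \<open>(- 1) ^ i\<close> of the right problem.\<close>
    have "?k ^ (i + 1) = - ((- 1) ^ i * (\<alpha> - \<beta>) ^ (i + 1))" for i
      by (subst power_minus) simp
    then have "(\<Sum>i\<le>n. real (n choose i) * ?k ^ (i + 1) * nth_deriv_within S (n - i) (g \<circ> A) z) =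
        - (\<Sum>i\<le>n. real (n choose i) * (- 1) ^ i * (\<alpha> - \<beta>) ^ (i + 1) * nth_deriv_within S (n - i) (g \<circ> A) z)"
      unfolding sum_negf[symmetric] by (intro sum.cong refl) (simp only: mult_minus_left mult_minus_right mult.assoc)
    moreover have "\<forall>n. \<forall>z\<in>D. nth_deriv_within S n ?G z = ?c * exp (?k * z) *
        (\<Sum>i\<le>n. real (n choose i) * ?k ^ (i + 1) * nth_deriv_within S (n - i) (g \<circ> A) z)"
      by (rule series_solution[OF openin nontriv z0 P G ck ode])
    ultimately show ?thesis
      using that by (simp only: mult_minus_left mult_minus_right minus_minus)
  qed
  then show ?thesis
  proof (intro conjI)
    show "a 0 = Q u\<^sub>0"
      using P(2)[OF z0] P(3)[of 0] sol by (simp add: solves_right_def)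
  qed (blast | rule series_solution[OF openin nontriv z0 P G ck ode]; assumption)+
qed

end

theorem mainTheorem6:
  fixes lam \<alpha> \<beta> :: real
  assumes "lam > 0" and "\<alpha> > 0" and "\<bar>\<beta>\<bar> < \<alpha>"
  shows
    "(\<exists>!A. \<forall>u\<in>{0<..<1}. vg_quantile lam \<alpha> \<beta> u = A (base_quantile lam \<alpha> \<beta> u)) \<and>
     (\<forall>A. (\<forall>u\<in>{0<..<1}. vg_quantile lam \<alpha> \<beta> u = A (base_quantile lam \<alpha> \<beta> u)) \<longrightarrow>
        (\<forall>u\<^sub>0\<in>{0<..p_minus lam \<alpha> \<beta>}. solves_left lam \<alpha> \<beta> u\<^sub>0 UNIV A) \<and>
        (\<forall>u\<^sub>0\<in>{p_minus lam \<alpha> \<beta>..<1}. solves_right lam \<alpha> \<beta> u\<^sub>0 UNIV A)) \<and>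
     (\<forall>n y. y \<noteq> 0 \<longrightarrow>
        (deriv ^^ n) (vg_g lam \<alpha> \<beta>) field_differentiable at y \<and>
        (deriv ^^ n) (vg_g lam \<alpha> \<beta>) y = g_deriv lam \<alpha> \<beta> n y) \<and>
     (\<forall>u\<^sub>0 z\<^sub>0 r A a S D.
        u\<^sub>0 \<in> {0<..p_minus lam \<alpha> \<beta>} \<and> z\<^sub>0 = base_quantile lam \<alpha> \<beta> u\<^sub>0 \<and> r > 0 \<and>
        S = left_dom lam \<alpha> \<beta> \<and> D = S \<inter> ball z\<^sub>0 r \<and>
        solves_left lam \<alpha> \<beta> u\<^sub>0 (ball z\<^sub>0 r) A \<and> has_series_on A a z\<^sub>0 D \<longrightarrow>
        a 0 = vg_quantile lam \<alpha> \<beta> u\<^sub>0 \<and>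
        (\<forall>n\<ge>1. a n = nth_deriv_within S (n - 1) (g_L lam \<alpha> \<beta> A) z\<^sub>0 / fact n) \<and>
        smooth_within S D (g_L lam \<alpha> \<beta> A) \<and>
        smooth_within S D (vg_g lam \<alpha> \<beta> \<circ> A) \<and>
        (\<forall>n. \<forall>z\<in>D. nth_deriv_within S n (g_L lam \<alpha> \<beta> A) z =
           p_minus lam \<alpha> \<beta> * exp ((\<alpha> + \<beta>) * z) *
           (\<Sum>k\<le>n. real (n choose k) * (\<alpha> + \<beta>) ^ (k + 1) *
              nth_deriv_within S (n - k) (vg_g lam \<alpha> \<beta> \<circ> A) z)) \<and>
        gA_formula lam \<alpha> \<beta> S D A (g_L lam \<alpha> \<beta> A)) \<and>
     (\<forall>u\<^sub>0 z\<^sub>0 r A a S D.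
        u\<^sub>0 \<in> {p_minus lam \<alpha> \<beta>..<1} \<and> z\<^sub>0 = base_quantile lam \<alpha> \<beta> u\<^sub>0 \<and> r > 0 \<and>
        S = right_dom lam \<alpha> \<beta> u\<^sub>0 \<and> D = S \<inter> ball z\<^sub>0 r \<and>
        solves_right lam \<alpha> \<beta> u\<^sub>0 (ball z\<^sub>0 r) A \<and> has_series_on A a z\<^sub>0 D \<longrightarrow>
        a 0 = vg_quantile lam \<alpha> \<beta> u\<^sub>0 \<and>
        (\<forall>n\<ge>1. a n = nth_deriv_within S (n - 1) (g_R lam \<alpha> \<beta> A) z\<^sub>0 / fact n) \<and>
        smooth_within S D (g_R lam \<alpha> \<beta> A) \<and>
        smooth_within S D (vg_g lam \<alpha> \<beta> \<circ> A) \<and>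
        (\<forall>n. \<forall>z\<in>D. nth_deriv_within S n (g_R lam \<alpha> \<beta> A) z =
           p_plus lam \<alpha> \<beta> * exp (- (\<alpha> - \<beta>) * z) *
           (\<Sum>k\<le>n. real (n choose k) * (- 1) ^ k * (\<alpha> - \<beta>) ^ (k + 1) *
              nth_deriv_within S (n - k) (vg_g lam \<alpha> \<beta> \<circ> A) z)) \<and>
        gA_formula lam \<alpha> \<beta> S D A (g_R lam \<alpha> \<beta> A))"
proof -
  interpret vg_parameters lam \<alpha> \<beta>
    using assms by unfold_locales
  show ?thesis
  proof (intro conjI)
    show "\<exists>!A. \<forall>u\<in>{0<..<1}. Q u = A (B u)"
      by (simp only: quantile_transform_iff ex1_eq)
    show "\<forall>A. (\<forall>u\<in>{0<..<1}. Q u = A (B u)) \<longrightarrow>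
        (\<forall>u\<^sub>0\<in>{0<..p}. solves_left lam \<alpha> \<beta> u\<^sub>0 UNIV A) \<and>
        (\<forall>u\<^sub>0\<in>{p..<1}. solves_right lam \<alpha> \<beta> u\<^sub>0 UNIV A)"
      by (simp add: quantile_transform_iff solves_left_QU solves_right_QU)
    show "\<forall>n y. y \<noteq> 0 \<longrightarrow> (deriv ^^ n) g field_differentiable at y \<and> (deriv ^^ n) g y = g' n y"
      by (simp add: deriv_funpow_g deriv_funpow_g_differentiable)
  qed (intro allI impI; elim conjE; hypsubst; rule left_series right_series; (assumption | rule refl))+
qed

end
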